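(* Let $\psi_0$ and $\psi_1$ be mutually orthogonal unit vectors in a Hilbert space $\mathcal{H}$, and let $\tau\in\mathcal{T}(\mathcal{K})$ be a state on a Hilbert space $\mathcal{K}$. Let $U:\mathcal{K}\otimes\mathcal{H}\to\mathcal{K}\otimes\mathcal{H}$ be unitary and define $T:\mathcal{T}(\mathcal{H})\to\mathcal{T}(\mathcal{K}\otimes\mathcal{H})$ by $T(\rho)=U(\tau\otimes\rho)U^*$. Let $B$ be a bounded self-adjoint operator on $\mathcal{K}\otimes\mathcal{H}$, and for $j=0,1$ denote by $b_j$ and $\sigma_j^2$ its expected value and variance in the state $T(|\psi_j\rangle\langle\psi_j|)$. Suppose that $b_0\neq b_1$. Then for all $\psi=\alpha_0\psi_0+\alpha_1\psi_1$ with $\alpha_0,\alpha_1\in\mathbb{C}$, $|\alpha_0|^2+|\alpha_1|^2=1$, for all $\delta\ge 0$, and for all bounded self-adjoint operators $A$ on $\mathcal{K}\otimes\mathcal{H}$ such that $\|[A,B]\|\le\delta\|A\|\cdot\|B\|$, we have $$\Bigl|\operatorname{tr}\bigl(T(|\psi\rangle\langle\psi|)A\bigr)-\operatorname{tr}\Bigl(T\bigl(|\alpha_0|^2|\psi_0\rangle\langle\psi_0|+|\alpha_1|^2|\psi_1\rangle\langle\psi_1|\bigr)A\Bigr)\Bigr|\le\frac{\delta\|B\|+\sigma_0+\sigma_1}{|b_0-b_1|}\,\|A\|.$$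
   Context: Hilbert spaces are complex. $\mathcal{T}(\mathcal{H})$ denotes the space of trace class operators on $\mathcal{H}$; a state $\tau\in\mathcal{T}(\mathcal{K})$ is a positive trace class operator of trace $1$. The expected value of $B$ in the state $\theta$ is $\operatorname{tr}(\theta B)$ and its variance is $\operatorname{tr}(\theta B^2)-\operatorname{tr}(\theta B)^2$; $\sigma_j\ge 0$ is the square root of the variance $\sigma_j^2$. $U^*$ is the adjoint of $U$ and $\|\cdot\|$ the operator norm. *)

theory Defs
  imports "HOL-Analysis.Analysis"
begin

section \<open>Complex Hilbert spaces\<close>

text \<open>
  A complex Hilbert space is presented as a complete real inner product space (whose inner product
  is the real part of the complex one) with a compatible complex structure. Positive definiteness
  of \<open>cinner\<close> and \<open>norm x = sqrt (Re (cinner x x))\<close> are inherited from \<open>real_inner\<close>. The inner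
  product is linear in its second argument.
\<close>

class chilbert_space = real_inner + complete_space +
  fixes scaleC :: "complex \<Rightarrow> 'a \<Rightarrow> 'a"  (infixr \<open>*\<^sub>C\<close> 75)
    and cinner :: "'a \<Rightarrow> 'a \<Rightarrow> complex"
  assumes scaleC_add_right: "c *\<^sub>C (x + y) = c *\<^sub>C x + c *\<^sub>C y"
    and scaleC_add_left: "(c + d) *\<^sub>C x = c *\<^sub>C x + d *\<^sub>C x"
    and scaleC_scaleC: "c *\<^sub>C d *\<^sub>C x = (c * d) *\<^sub>C x"
    and scaleC_of_real: "complex_of_real r *\<^sub>C x = r *\<^sub>R x"
    and cinner_commute: "cinner x y = cnj (cinner y x)"
    and cinner_add_right: "cinner x (y + z) = cinner x y + cinner x z"
    and cinner_scaleC_right: "cinner x (c *\<^sub>C y) = c * cinner x y"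
    and Re_cinner: "Re (cinner x y) = inner x y"

lemma vector_space_scaleC: "vector_space (scaleC :: complex \<Rightarrow> 'a \<Rightarrow> 'a::chilbert_space)"
  using scaleC_of_real[of 1]
  by unfold_locales (simp_all add: scaleC_add_right scaleC_add_left scaleC_scaleC)

instantiation complex :: chilbert_space
begin

definition scaleC_complex :: "complex \<Rightarrow> complex \<Rightarrow> complex"
  where "scaleC_complex c x = c * x"

definition cinner_complex :: "complex \<Rightarrow> complex \<Rightarrow> complex"
  where "cinner_complex x y = cnj x * y"

instance
  by standard
    (auto simp: scaleC_complex_def cinner_complex_def inner_complex_def scaleR_conv_of_real
      algebra_simps)

end

abbreviation cspan :: "'a::chilbert_space set \<Rightarrow> 'a set"
  where "cspan \<equiv> module.span scaleC"

abbreviation clinear :: "('a::chilbert_space \<Rightarrow> 'b::chilbert_space) \<Rightarrow> bool"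
  where "clinear \<equiv> Vector_Spaces.linear scaleC scaleC"

definition is_onb :: "'a::chilbert_space set \<Rightarrow> bool"
  where "is_onb E \<longleftrightarrow>
    (\<forall>e\<in>E. norm e = 1) \<and> (\<forall>e\<in>E. \<forall>f\<in>E. e \<noteq> f \<longrightarrow> cinner e f = 0) \<and>
    closure (cspan E) = UNIV"


section \<open>Bounded operators\<close>

text \<open>Operators are functions; the operator norm is the library's \<open>onorm\<close>.\<close>

definition bounded_clinear :: "('a::chilbert_space \<Rightarrow> 'b::chilbert_space) \<Rightarrow> bool"
  where "bounded_clinear A \<longleftrightarrow> clinear A \<and> (\<exists>K. \<forall>x. norm (A x) \<le> norm x * K)"

definition cadjoint :: "('a::chilbert_space \<Rightarrow> 'b::chilbert_space) \<Rightarrow> 'b \<Rightarrow> 'a"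
  where "cadjoint A = (THE A'. \<forall>x y. cinner (A' y) x = cinner y (A x))"

definition selfadjoint_op :: "('a::chilbert_space \<Rightarrow> 'a) \<Rightarrow> bool"
  where "selfadjoint_op A \<longleftrightarrow> bounded_clinear A \<and> cadjoint A = A"

definition unitary_op :: "('a::chilbert_space \<Rightarrow> 'a) \<Rightarrow> bool"
  where "unitary_op U \<longleftrightarrow> bounded_clinear U \<and> cadjoint U \<circ> U = id \<and> U \<circ> cadjoint U = id"

definition positive_op :: "('a::chilbert_space \<Rightarrow> 'a) \<Rightarrow> bool"
  where "positive_op A \<longleftrightarrow> bounded_clinear A \<and> (\<forall>x. cinner x (A x) \<in> \<real>\<^sub>\<ge>\<^sub>0)"

definition commutator :: "('a::chilbert_space \<Rightarrow> 'a) \<Rightarrow> ('a \<Rightarrow> 'a) \<Rightarrow> 'a \<Rightarrow> 'a"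
  where "commutator A B = (\<lambda>x. A (B x) - B (A x))"

definition rank_one_proj :: "'a::chilbert_space \<Rightarrow> 'a \<Rightarrow> 'a"
  where "rank_one_proj \<psi> = (\<lambda>x. cinner \<psi> x *\<^sub>C \<psi>)"


section \<open>Trace class operators, states, moments\<close>

definition abs_op :: "('a::chilbert_space \<Rightarrow> 'b::chilbert_space) \<Rightarrow> 'a \<Rightarrow> 'a"
  where "abs_op A = (THE P. positive_op P \<and> P \<circ> P = cadjoint A \<circ> A)"

definition trace_class :: "('a::chilbert_space \<Rightarrow> 'a) \<Rightarrow> bool"
  where "trace_class A \<longleftrightarrow> bounded_clinear A \<and>
    (\<exists>E. is_onb E \<and> (\<lambda>e. cinner e (abs_op A e)) summable_on E)"

text \<open>For trace class operators the sum does not depend on the chosen orthonormal basis; for other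
  operators the value is not meaningful.\<close>

definition op_trace :: "('a::chilbert_space \<Rightarrow> 'a) \<Rightarrow> complex"
  where "op_trace A = (\<Sum>\<^sub>\<infinity>e\<in>(SOME E. is_onb E). cinner e (A e))"

definition is_state :: "('a::chilbert_space \<Rightarrow> 'a) \<Rightarrow> bool"
  where "is_state \<tau> \<longleftrightarrow> trace_class \<tau> \<and> positive_op \<tau> \<and> op_trace \<tau> = 1"

text \<open>The traces below are real when \<open>\<theta>\<close> is a state and \<open>B\<close> is bounded and self-adjoint;
  \<open>Re\<close> only changes the type.\<close>

definition expected_value :: "('a::chilbert_space \<Rightarrow> 'a) \<Rightarrow> ('a \<Rightarrow> 'a) \<Rightarrow> real"
  where "expected_value \<theta> B = Re (op_trace (\<theta> \<circ> B))"

definition op_variance :: "('a::chilbert_space \<Rightarrow> 'a) \<Rightarrow> ('a \<Rightarrow> 'a) \<Rightarrow> real"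
  where "op_variance \<theta> B = Re (op_trace (\<theta> \<circ> (B \<circ> B))) - (expected_value \<theta> B)\<^sup>2"


section \<open>Hilbert space tensor products\<close>

text \<open>
  \<open>is_hilbert_tensor tens\<close>: the Hilbert space \<open>'l\<close>, with \<open>tens x y\<close> as the elementary tensor of
  \<open>x\<close> and \<open>y\<close>, is a Hilbert space tensor product of \<open>'k\<close> and \<open>'h\<close>, i.e. the completion of the
  algebraic tensor product with respect to the product inner product. This determines \<open>'l\<close> and
  \<open>tens\<close> up to a unique unitary.
\<close>

definition is_hilbert_tensor ::
  "('k::chilbert_space \<Rightarrow> 'h::chilbert_space \<Rightarrow> 'l::chilbert_space) \<Rightarrow> bool"
  where "is_hilbert_tensor tens \<longleftrightarrow>
    (\<forall>y. clinear (\<lambda>x. tens x y)) \<and> (\<forall>x. clinear (\<lambda>y. tens x y)) \<and>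
    (\<forall>x y x' y'. cinner (tens x y) (tens x' y') = cinner x x' * cinner y y') \<and>
    closure (cspan {tens x y |x y. True}) = UNIV"

text \<open>The operator \<open>R \<otimes> S\<close>, i.e. the bounded operator acting as
  \<open>tens x y \<mapsto> tens (R x) (S y)\<close> on elementary tensors.\<close>

definition tensor_op ::
  "('k::chilbert_space \<Rightarrow> 'h::chilbert_space \<Rightarrow> 'l::chilbert_space)
    \<Rightarrow> ('k \<Rightarrow> 'k) \<Rightarrow> ('h \<Rightarrow> 'h) \<Rightarrow> 'l \<Rightarrow> 'l"
  where "tensor_op tens R S =
    (THE X. bounded_clinear X \<and> (\<forall>x y. X (tens x y) = tens (R x) (S y)))"

end

(* The state T(|xi><xi|) is W tau W* with W x = U (x (x) xi).  Writing tau = S S with S self-adjoint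
   and Hilbert-Schmidt, cyclicity of the trace gives tr (T(|xi><xi|) C) = sum_e <phi_e, C phi_e> over
   an orthonormal basis, with phi_e = U (S e (x) xi) depending linearly on xi.  So a state is a
   square-summable family of vectors, and the difference in the theorem is at most |D| for the cross
   term D = sum_e <phi0_e, A phi1_e>.  Summing
     (b0 - b1) <phi0, A phi1> = <phi0, A (B - b1) phi1> - <(B - b0) phi0, A phi1> - <phi0, [A, B] phi1>
   and applying Cauchy-Schwarz bounds |b0 - b1| |D|, because sum_e |(B - bj) phij_e|^2 is the
   variance sigma_j^2. *)

theory Submission
  imports Defs
begin

section \<open>Complex inner products and bounded operators\<close>

text \<open>The trace is a sum over one basis picked by \<open>SOME\<close>, and
  \<open>cadjoint\<close> and \<open>tensor_op\<close> are definite descriptions, so nothing can be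
  computed before bases, adjoints and explicit witnesses exist. Completeness supplies them:
  projection onto closed subspaces gives the Riesz representation, hence adjoints, and together with
  Zorn's lemma orthonormal bases. Real statements pass to the complex setting by testing against
  both x and i x. Factoring tau through S is what makes cyclicity elementary: the trace becomes a
  pairing of two Hilbert-Schmidt operators, that is a double series whose terms are dominated by
  sums of squares, so that Fubini applies. This domination holds for every basis of the large space,
  hence also for the one over which the traces of the theorem are taken. S comes from a
  norm-convergent iteration for the square root of a positive operator.\<close>

instance chilbert_space \<subseteq> banach ..

interpretation scaleC: vector_space "scaleC :: complex \<Rightarrow> 'a \<Rightarrow> 'a::chilbert_space"
  by (rule vector_space_scaleC)

lemma cinner_add_left: "cinner (x + y) z = cinner x z + cinner y z"
  by (metis cinner_commute cinner_add_right complex_cnj_add)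

lemma cinner_scaleC_left: "cinner (c *\<^sub>C x) y = cnj c * cinner x y"
  by (metis cinner_commute cinner_scaleC_right complex_cnj_mult)

lemma cinner_scaleR_right: "cinner x (r *\<^sub>R y) = of_real r * cinner x y"
  by (metis cinner_scaleC_right scaleC_of_real)

lemma cinner_scaleR_left: "cinner (r *\<^sub>R x) y = of_real r * cinner x y"
  by (metis cinner_scaleC_left scaleC_of_real complex_cnj_complex_of_real)

lemma cinner_zero_right [simp]: "cinner x 0 = 0"
  using cinner_scaleR_right[of x 0 0] by simp

lemma cinner_zero_left [simp]: "cinner 0 x = 0"
  using cinner_scaleR_left[of 0 0 x] by simp

lemma cinner_minus_right: "cinner x (- y) = - cinner x y"
  using cinner_scaleR_right[of x "-1" y] by simp

lemma cinner_minus_left: "cinner (- x) y = - cinner x y"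
  using cinner_scaleR_left[of "-1" x y] by simp

lemma cinner_diff_right: "cinner x (y - z) = cinner x y - cinner x z"
  using cinner_add_right[of x y "- z"] by (simp add: cinner_minus_right)

lemma cinner_diff_left: "cinner (x - y) z = cinner x z - cinner y z"
  using cinner_add_left[of x "- y" z] by (simp add: cinner_minus_left)

lemmas cinner_simps = cinner_add_left cinner_add_right cinner_diff_left cinner_diff_right
  cinner_minus_left cinner_minus_right cinner_scaleC_left cinner_scaleC_right
  cinner_scaleR_left cinner_scaleR_right

lemma cinner_sum_left: "cinner (\<Sum>i\<in>I. f i) x = (\<Sum>i\<in>I. cinner (f i) x)"
  by (induction I rule: infinite_finite_induct) (simp_all add: cinner_add_left)

lemma cinner_sum_right: "cinner x (\<Sum>i\<in>I. f i) = (\<Sum>i\<in>I. cinner x (f i))"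
  by (induction I rule: infinite_finite_induct) (simp_all add: cinner_add_right)

text \<open>The real inner product determines the complex one. Through this identity, results proved
  for \<open>inner\<close> (projection, Riesz) are lifted to \<open>cinner\<close>.\<close>

lemma Im_cinner: "Im (cinner x y) = - inner x (\<i> *\<^sub>C y)"
  by (simp add: cinner_scaleC_right flip: Re_cinner)

lemma cinner_self: "cinner x x = of_real ((norm x)\<^sup>2)"
proof -
  have "Im (cinner x x) = 0"
    using arg_cong[OF cinner_commute[of x x], of Im] by simp
  then show ?thesis
    by (simp add: complex_eq_iff Re_cinner power2_norm_eq_inner)
qed

lemma norm_scaleC: "norm (c *\<^sub>C x) = cmod c * norm x"
proof -
  have "cinner (c *\<^sub>C x) (c *\<^sub>C x) = (c * cnj c) * cinner x x"
    by (simp only: cinner_simps mult.assoc)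
  then have "complex_of_real ((norm (c *\<^sub>C x))\<^sup>2) = of_real ((cmod c * norm x)\<^sup>2)"
    by (simp only: cinner_self complex_norm_square[symmetric] of_real_mult power_mult_distrib)
  then show ?thesis
    by (metis of_real_eq_iff mult_nonneg_nonneg norm_ge_zero power2_eq_imp_eq)
qed

text \<open>Rotating \<open>y\<close> by a unimodular \<open>c\<close> makes the inner product equal
  to its modulus; the real Cauchy-Schwarz inequality then applies.\<close>

lemma cmod_cinner_le: "cmod (cinner x y) \<le> norm x * norm y"
proof (cases "cinner x y = 0")
  case False
  define c where "c = cnj (cinner x y) / of_real (cmod (cinner x y))"
  have c: "cmod c = 1"
    using False by (simp add: c_def norm_divide)
  have "cinner x (c *\<^sub>C y) = of_real (cmod (cinner x y))"
    using False by (simp add: c_def cinner_simps complex_norm_square[symmetric] mult.commute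
        power2_eq_square divide_simps)
  then have "cmod (cinner x y) = inner x (c *\<^sub>C y)"
    by (metis Re_complex_of_real Re_cinner)
  also have "\<dots> \<le> norm x * norm (c *\<^sub>C y)"
    by (rule norm_cauchy_schwarz)
  finally show ?thesis
    by (simp add: norm_scaleC c)
qed simp

lemma clinear_iff:
  "clinear f \<longleftrightarrow> (\<forall>x y. f (x + y) = f x + f y) \<and> (\<forall>c x. f (c *\<^sub>C x) = c *\<^sub>C f x)"
  by (simp add: Vector_Spaces.linear_iff vector_space_scaleC)

lemma bounded_clinear_add: "bounded_clinear f \<Longrightarrow> f (x + y) = f x + f y"
  and bounded_clinear_scaleC: "bounded_clinear f \<Longrightarrow> f (c *\<^sub>C x) = c *\<^sub>C f x"
  by (simp_all add: bounded_clinear_def clinear_iff)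

lemma bounded_clinear_scaleR: "bounded_clinear f \<Longrightarrow> f (r *\<^sub>R x) = r *\<^sub>R f x"
  by (metis bounded_clinear_scaleC scaleC_of_real)

lemma bounded_clinear_imp_bounded_linear: "bounded_clinear f \<Longrightarrow> bounded_linear f"
  by (rule bounded_linear.intro)
    (auto simp: bounded_clinear_add bounded_clinear_scaleR bounded_linear_axioms_def intro!: linearI,
      auto simp: bounded_clinear_def)

text \<open>Separates boundedness from the complex structure, so that closure properties are
  inherited from real bounded linear maps and only homogeneity over the complex numbers remains to
  be checked.\<close>

lemma bounded_clinear_iff_bounded_linear:
  "bounded_clinear f \<longleftrightarrow> bounded_linear f \<and> (\<forall>c x. f (c *\<^sub>C x) = c *\<^sub>C f x)"
  by (auto simp: bounded_clinear_imp_bounded_linear bounded_clinear_scaleC)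
    (auto simp: bounded_clinear_def clinear_iff linear_add bounded_linear.linear
      dest: bounded_linear.bounded)

lemma bounded_clinear_compose:
  "bounded_clinear f \<Longrightarrow> bounded_clinear g \<Longrightarrow> bounded_clinear (\<lambda>x. f (g x))"
  by (auto simp: bounded_clinear_iff_bounded_linear intro: bounded_linear_compose)

lemma bounded_clinear_sum:
  "bounded_clinear f \<Longrightarrow> bounded_clinear g \<Longrightarrow> bounded_clinear (\<lambda>x. f x + g x)"
  by (auto simp: bounded_clinear_iff_bounded_linear scaleC_add_right intro: bounded_linear_add)

lemma scaleC_scaleR_commute: "c *\<^sub>C r *\<^sub>R x = r *\<^sub>R c *\<^sub>C x"
  by (metis mult.commute scaleC_of_real scaleC_scaleC)

lemma bounded_clinear_scaleR_comp:
  "bounded_clinear f \<Longrightarrow> bounded_clinear (\<lambda>x. r *\<^sub>R f x)"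
  by (auto simp: bounded_clinear_iff_bounded_linear scaleC_scaleR_commute
      intro: bounded_linear_const_scaleR)

lemma bounded_linear_cinner_right: "bounded_linear (cinner x)"
  by (rule bounded_linear_intro[where K = "norm x"])
    (auto simp: cinner_simps scaleR_conv_of_real cmod_cinner_le mult.commute[of "norm _" "norm x"])


section \<open>Projection theorem and adjoints\<close>

text \<open>The parallelogram law for \<open>x - y\<close> and \<open>x - z\<close>. It controls the
  distance of two approximate nearest points \<open>y\<close>, \<open>z\<close> by how far their
  midpoint is from \<open>x\<close>.\<close>

lemma parallelogram_diff:
  fixes x y z :: "'a::real_inner"
  shows "(norm (y - z))\<^sup>2 + 4 * (norm (x - (1/2) *\<^sub>R (y + z)))\<^sup>2
    = 2 * (norm (x - y))\<^sup>2 + 2 * (norm (x - z))\<^sup>2"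
  by (simp add: power2_norm_eq_inner inner_simps inner_commute algebra_simps)

lemma nearest_point_subspace:
  fixes M :: "'a::{real_inner, complete_space} set"
  assumes M: "subspace M" "closed M"
  obtains p where "p \<in> M" "\<And>m. m \<in> M \<Longrightarrow> norm (x - p) \<le> norm (x - m)"
proof -
  define d where "d = (INF m\<in>M. (norm (x - m))\<^sup>2)"
  have bdd: "bdd_below ((\<lambda>m. (norm (x - m))\<^sup>2) ` M)"
    by (rule bdd_belowI[of _ 0]) auto
  have d_le: "d \<le> (norm (x - m))\<^sup>2" if "m \<in> M" for m
    unfolding d_def by (rule cINF_lower[OF bdd that])
  have "\<exists>m\<in>M. (norm (x - m))\<^sup>2 < d + 1 / Suc n" for n
  proof (rule ccontr)
    assume "\<not> ?thesis"
    then have "d + 1 / Suc n \<le> d"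
      unfolding d_def using M(1) by (intro cINF_greatest) (auto simp: not_less subspace_def)
    then show False
      by simp
  qed
  then obtain m where m: "\<And>n. m n \<in> M" "\<And>n. (norm (x - m n))\<^sup>2 < d + 1 / Suc n"
    by metis
  \<comment> \<open>The midpoint lies in \<open>M\<close>, so its squared distance to
    \<open>x\<close> is at least \<open>d\<close>; the four copies of \<open>d\<close> cancel in the
    parallelogram law and only the two excesses remain.\<close>
  have mm: "(norm (m i - m j))\<^sup>2 < 2 / Suc i + 2 / Suc j" for i j
  proof -
    have "(1/2) *\<^sub>R (m i + m j) \<in> M"
      using M(1) m(1) by (simp add: subspace_def)
    from d_le[OF this] parallelogram_diff[of "m i" "m j" x] m(2)[of i] m(2)[of j] show ?thesis
      by simp
  qed
  have "Cauchy m"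
  proof (rule metric_CauchyI)
    fix e :: real assume e: "e > 0"
    \<comment> \<open>The quarter accounts for the two terms \<open>2 / Suc i\<close> and
      \<open>2 / Suc j\<close>, each below half of the square of \<open>e\<close>.\<close>
    obtain N where N: "1 / Suc N < e\<^sup>2 / 4"
      using e reals_Archimedean[of "e\<^sup>2 / 4"] by (auto simp: inverse_eq_divide)
    have "dist (m i) (m j) < e" if "i \<ge> N" "j \<ge> N" for i j
    proof -
      have "1 / Suc i \<le> 1 / Suc N" "1 / Suc j \<le> 1 / Suc N"
        using that by (auto intro!: divide_left_mono)
      then have "(norm (m i - m j))\<^sup>2 < e\<^sup>2"
        using mm[of i j] N by simp
      then show ?thesis
        using e by (auto simp: dist_norm intro: power_less_imp_less_base)
    qed
    then show "\<exists>N. \<forall>i\<ge>N. \<forall>j\<ge>N. dist (m i) (m j) < e"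
      by blast
  qed
  then obtain p where p: "m \<longlonglongrightarrow> p"
    using Cauchy_convergent convergent_def by blast
  have "p \<in> M"
    using closed_sequentially[OF M(2)] m(1) p by blast
  have "(\<lambda>n. (norm (x - m n))\<^sup>2) \<longlonglongrightarrow> (norm (x - p))\<^sup>2"
    by (intro tendsto_intros p)
  moreover have "(\<lambda>n. d + 1 / real (Suc n)) \<longlonglongrightarrow> d + 0"
    by (intro tendsto_intros LIMSEQ_Suc[OF lim_1_over_n])
  ultimately have "(norm (x - p))\<^sup>2 \<le> d + 0"
    by (rule LIMSEQ_le) (use m(2) less_imp_le in blast)
  then have "norm (x - p) \<le> norm (x - k)" if "k \<in> M" for k
    using d_le[OF that] by (simp add: power2_le_imp_le)
  with \<open>p \<in> M\<close> show ?thesis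
    by (rule that)
qed

lemma orthogonal_projection_subspace:
  fixes M :: "'a::{real_inner, complete_space} set"
  assumes M: "subspace M" "closed M"
  obtains p where "p \<in> M" "\<And>m. m \<in> M \<Longrightarrow> inner (x - p) m = 0"
proof -
  obtain p where p: "p \<in> M" and le: "\<And>m. m \<in> M \<Longrightarrow> norm (x - p) \<le> norm (x - m)"
    using nearest_point_subspace[OF M, of x] by blast
  have "inner (x - p) m = 0" if m: "m \<in> M" for m
  proof (cases "m = 0")
    case False
    \<comment> \<open>The step along \<open>m\<close> that minimises the quadratic in
      \<open>t\<close>. Minimality of \<open>p\<close> then forces the gain, the squared inner
      product divided by \<open>inner m m\<close>, to be at most 0.\<close>
    define t where "t = inner (x - p) m / inner m m"
    have "p + t *\<^sub>R m \<in> M"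
      using M(1) p m by (simp add: subspace_def)
    from le[OF this] have "inner (x - p) (x - p) \<le> inner (x - (p + t *\<^sub>R m)) (x - (p + t *\<^sub>R m))"
      by (simp add: norm_le)
    also have "x - (p + t *\<^sub>R m) = (x - p) - t *\<^sub>R m"
      by simp
    also have "inner \<dots> \<dots> = inner (x - p) (x - p) - 2 * t * inner (x - p) m + t * (t * inner m m)"
      by (simp only: inner_diff_left inner_diff_right inner_scaleR_left inner_scaleR_right)
        (simp add: inner_commute algebra_simps)
    also have "t * inner m m = inner (x - p) m"
      using False by (simp add: t_def)
    finally have "inner (x - p) m * inner (x - p) m / inner m m \<le> 0"
      by (simp add: t_def)
    moreover have "inner m m > 0"
      using False by simp
    ultimately have "inner (x - p) m * inner (x - p) m \<le> 0"
      by (simp add: divide_le_0_iff)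
    then show ?thesis
      by (auto simp: mult_le_0_iff)
  qed simp
  with p show ?thesis
    by (rule that)
qed

text \<open>The kernel of \<open>f\<close> is a closed hyperplane. The residual \<open>z\<close> of
  a point outside it is orthogonal to the kernel, and every vector is a multiple of \<open>z\<close>
  up to an element of the kernel.\<close>

lemma riesz_real:
  fixes f :: "'a::{real_inner, complete_space} \<Rightarrow> real"
  assumes f: "bounded_linear f"
  obtains y where "\<And>x. f x = inner y x"
proof (cases "\<forall>x. f x = 0")
  case True
  with that[of 0] show ?thesis by simp
next
  case False
  then obtain x where x: "f x \<noteq> 0"
    by blast
  interpret f: bounded_linear f by fact
  define M where "M = {m. f m = 0}"
  have "subspace M"
    by (simp add: M_def subspace_def f.add f.scaleR)
  moreover have "closed M"
    unfolding M_def by (intro closed_Collect_eq continuous_intros f.continuous_on)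
  ultimately obtain p where p: "p \<in> M" "\<And>m. m \<in> M \<Longrightarrow> inner (x - p) m = 0"
    using orthogonal_projection_subspace by blast
  define z where "z = x - p"
  have fz: "f z \<noteq> 0"
    using p(1) x by (simp add: z_def f.diff M_def)
  then have "inner z z \<noteq> 0"
    by auto
  have "f v = inner ((f z / inner z z) *\<^sub>R z) v" for v
  proof -
    have "v - (f v / f z) *\<^sub>R z \<in> M"
      using fz by (simp add: M_def f.diff f.scaleR)
    from p(2)[OF this] have "inner z v = (f v / f z) * inner z z"
      by (simp add: z_def[symmetric] inner_diff_right)
    then show ?thesis
      using fz \<open>inner z z \<noteq> 0\<close> by simp
  qed
  then show ?thesis
    by (rule that)
qed

text \<open>The description defining \<open>cadjoint\<close> has to be shown to denote. Riesz gives
  a vector with the right real parts; replacing \<open>x\<close> by i x and using complex linearity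
  of \<open>A\<close> gives the imaginary parts. Uniqueness is nondegeneracy of
  \<open>inner\<close>.\<close>

lemma cinner_cadjoint_left:
  assumes A: "bounded_clinear A"
  shows "cinner (cadjoint A y) x = cinner y (A x)"
proof -
  have "\<exists>z. \<forall>x. cinner z x = cinner y (A x)" for y
  proof -
    obtain z where z: "\<And>x. inner y (A x) = inner z x"
      using riesz_real[of "\<lambda>x. inner y (A x)"] bounded_clinear_imp_bounded_linear[OF A]
        bounded_linear_compose[OF bounded_linear_inner_right] by metis
    have "cinner z x = cinner y (A x)" for x
      by (simp add: complex_eq_iff Re_cinner Im_cinner z[symmetric] bounded_clinear_scaleC[OF A])
    then show ?thesis
      by blast
  qed
  then obtain A' where A': "\<And>x y. cinner (A' y) x = cinner y (A x)"
    by metis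
  have "cadjoint A = A'"
    unfolding cadjoint_def
  proof (rule the_equality)
    fix A'' assume "\<forall>x y. cinner (A'' y) x = cinner y (A x)"
    then have "inner (A'' y) x = inner (A' y) x" for x y
      by (metis A' Re_cinner)
    then show "A'' = A'"
      by (metis ext vector_eq_rdot)
  qed (simp add: A')
  then show ?thesis
    by (simp add: A')
qed

lemma cinner_cadjoint_right:
  "bounded_clinear A \<Longrightarrow> cinner x (cadjoint A y) = cinner (A x) y"
  by (metis cinner_commute cinner_cadjoint_left)

lemma cinner_extI: "(\<And>x. cinner y x = cinner z x) \<Longrightarrow> y = z"
  by (metis Re_cinner vector_eq_rdot)

lemma bounded_clinear_cadjoint:
  assumes A: "bounded_clinear A"
  shows "bounded_clinear (cadjoint A)"
proof -
  obtain K where K: "K \<ge> 0" "\<And>x. norm (A x) \<le> norm x * K"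
    using bounded_linear.nonneg_bounded[OF bounded_clinear_imp_bounded_linear[OF A]] by blast
  have "norm (cadjoint A y) \<le> norm y * K" for y
  proof -
    have "(norm (cadjoint A y))\<^sup>2 = inner y (A (cadjoint A y))"
      by (metis Re_cinner cinner_cadjoint_left[OF A] power2_norm_eq_inner)
    also have "\<dots> \<le> norm y * (norm (cadjoint A y) * K)"
      by (meson K(2) norm_cauchy_schwarz mult_left_mono norm_ge_zero order_trans)
    finally have le: "norm (cadjoint A y) * norm (cadjoint A y) \<le> norm (cadjoint A y) * (norm y * K)"
      by (simp add: power2_eq_square ac_simps)
    show ?thesis
      using le K(1) by (cases "cadjoint A y = 0") simp_all
  qed
  moreover have "clinear (cadjoint A)"
    unfolding clinear_iff
  proof (intro conjI allI)
    fix x y c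
    show "cadjoint A (x + y) = cadjoint A x + cadjoint A y"
      by (rule cinner_extI) (simp only: cinner_simps cinner_cadjoint_left[OF A])
    show "cadjoint A (c *\<^sub>C x) = c *\<^sub>C cadjoint A x"
      by (rule cinner_extI) (simp only: cinner_simps cinner_cadjoint_left[OF A])
  qed
  ultimately show ?thesis
    by (auto simp: bounded_clinear_def)
qed


section \<open>Orthonormal bases\<close>

definition orthonormal :: "'a::chilbert_space set \<Rightarrow> bool"
  where "orthonormal E \<longleftrightarrow> (\<forall>e\<in>E. norm e = 1) \<and> (\<forall>e\<in>E. \<forall>f\<in>E. e \<noteq> f \<longrightarrow> cinner e f = 0)"

lemma is_onb_iff: "is_onb E \<longleftrightarrow> orthonormal E \<and> closure (cspan E) = UNIV"
  by (simp add: is_onb_def orthonormal_def)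

lemma subspace_closure:
  fixes S :: "'a::real_normed_vector set"
  assumes S: "subspace S"
  shows "subspace (closure S)"
  unfolding subspace_def
proof (intro conjI ballI allI)
  show "0 \<in> closure S"
    using S closure_subset subspace_0 by blast
next
  fix x y assume "x \<in> closure S" "y \<in> closure S"
  then obtain f g where "\<And>n. f n \<in> S" "f \<longlonglongrightarrow> x" "\<And>n. g n \<in> S" "g \<longlonglongrightarrow> y"
    by (auto simp: closure_sequential)
  then show "x + y \<in> closure S"
    unfolding closure_sequential
    by (intro exI[of _ "\<lambda>n. f n + g n"]) (auto intro: tendsto_add subspace_add[OF S])
next
  fix c x assume "x \<in> closure S"
  then obtain f where "\<And>n. f n \<in> S" "f \<longlonglongrightarrow> x"
    by (auto simp: closure_sequential)
  then show "c *\<^sub>R x \<in> closure S"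
    unfolding closure_sequential
    by (intro exI[of _ "\<lambda>n. c *\<^sub>R f n"]) (auto intro: tendsto_intros subspace_scale[OF S])
qed

lemma subspace_cspan: "subspace (cspan E)"
  unfolding subspace_def
  by (metis scaleC.span_add scaleC.span_scale scaleC.span_zero scaleC_of_real)

text \<open>Zorn's lemma yields a maximal orthonormal set. If its span were not dense, the
  normalised residual of a vector outside the closure would extend it. This ensures that the
  \<open>SOME\<close> in \<open>op_trace\<close> picks a genuine basis.\<close>

lemma exists_onb: "\<exists>E::'a::chilbert_space set. is_onb E"
proof -
  have "\<exists>M\<in>Collect orthonormal. \<forall>X\<in>Collect orthonormal. M \<subseteq> X \<longrightarrow> X = (M::'a set)"
  proof (rule subset_Zorn')
    fix C :: "'a set set" assume C: "subset.chain (Collect orthonormal) C"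
    have "\<exists>X\<in>C. e \<in> X \<and> f \<in> X" if "e \<in> \<Union>C" "f \<in> \<Union>C" for e f
    proof -
      obtain X Y where XY: "X \<in> C" "Y \<in> C" "e \<in> X" "f \<in> Y"
        using \<open>e \<in> \<Union>C\<close> \<open>f \<in> \<Union>C\<close> by blast
      then have "X \<subseteq> Y \<or> Y \<subseteq> X"
        using C by (auto simp: subset_chain_def)
      with XY show ?thesis
        by blast
    qed
    moreover have "orthonormal X" if "X \<in> C" for X
      using that C by (auto simp: subset_chain_def)
    ultimately show "\<Union>C \<in> Collect orthonormal"
      unfolding orthonormal_def mem_Collect_eq by blast
  qed
  then obtain M :: "'a set" where M: "orthonormal M"
    and max: "\<And>X. orthonormal X \<Longrightarrow> M \<subseteq> X \<Longrightarrow> X = M"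
    by auto
  have "closure (cspan M) = UNIV"
  proof (rule ccontr)
    assume "closure (cspan M) \<noteq> UNIV"
    then obtain x where x: "x \<notin> closure (cspan M)"
      by blast
    obtain p where p: "p \<in> closure (cspan M)" "\<And>m. m \<in> closure (cspan M) \<Longrightarrow> inner (x - p) m = 0"
      using orthogonal_projection_subspace[OF subspace_closure[OF subspace_cspan] closed_closure]
      by blast
    have "x - p \<noteq> 0"
      using p(1) x by auto
    define z where "z = (1 / norm (x - p)) *\<^sub>R (x - p)"
    have z: "norm z = 1"
      using \<open>x - p \<noteq> 0\<close> by (simp add: z_def)
    have "cinner z e = 0" if "e \<in> M" for e
    proof -
      \<comment> \<open>Real orthogonality to both \<open>e\<close> and i e amounts to complex
        orthogonality to \<open>e\<close>.\<close>
      have "e \<in> cspan M" "\<i> *\<^sub>C e \<in> cspan M"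
        using that by (simp_all add: scaleC.span_base scaleC.span_scale)
      then have "e \<in> closure (cspan M)" "\<i> *\<^sub>C e \<in> closure (cspan M)"
        using closure_subset by (metis subsetD)+
      then show ?thesis
        by (simp add: complex_eq_iff Re_cinner Im_cinner z_def p(2))
    qed
    moreover from this have "cinner e z = 0" if "e \<in> M" for e
      using that cinner_commute[of e z] by simp
    ultimately have "orthonormal (insert z M)"
      using M z by (auto simp: orthonormal_def)
    then have "z \<in> M"
      using max by blast
    then have "cinner z z = 0"
      by fact
    with z show False
      by (simp add: cinner_self)
  qed
  with M show ?thesis
    by (auto simp: is_onb_iff)
qed

lemma orthonormal_cinner_sum:
  assumes "orthonormal E" "finite G" "G \<subseteq> E" "e \<in> G"
  shows "cinner e (\<Sum>f\<in>G. c f *\<^sub>C f) = c e"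
proof -
  have "cinner e (\<Sum>f\<in>G. c f *\<^sub>C f) = (\<Sum>f\<in>G. if f = e then c e else 0)"
    unfolding cinner_sum_right
    using assms by (intro sum.cong) (auto simp: cinner_simps orthonormal_def cinner_self subset_iff)
  then show ?thesis
    using assms by simp
qed

text \<open>Pythagoras: the finite expansion is orthogonal to its residual. The bound is uniform in
  \<open>G\<close>, which is what turns density of the span into convergence of expansions.\<close>

lemma norm_residual_le:
  assumes "orthonormal E" "finite G" "G \<subseteq> E"
  shows "norm (x - (\<Sum>e\<in>G. cinner e x *\<^sub>C e)) \<le> norm x"
proof -
  define p where "p = (\<Sum>e\<in>G. cinner e x *\<^sub>C e)"
  have "cinner e (x - p) = 0" if "e \<in> G" for e
    using orthonormal_cinner_sum[OF assms that, of "\<lambda>e. cinner e x"]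
    by (simp add: p_def cinner_diff_right)
  then have "cinner p (x - p) = 0"
    by (subst p_def) (simp add: cinner_sum_left cinner_scaleC_left)
  then have "inner p (x - p) = 0"
    by (simp flip: Re_cinner)
  then have "(norm x)\<^sup>2 = (norm p)\<^sup>2 + (norm (x - p))\<^sup>2"
    by (simp add: power2_norm_eq_inner inner_simps inner_commute)
  then have "(norm (x - p))\<^sup>2 \<le> (norm x)\<^sup>2"
    by simp
  then show ?thesis
    unfolding p_def by (rule power2_le_imp_le) simp
qed

text \<open>On the algebraic span the finite partial sums are eventually exact. A general
  \<open>x\<close> is approximated by such a vector, and the error is not enlarged because the
  residual map is norm-nonincreasing.\<close>

lemma onb_expansion:
  fixes x :: "'a::chilbert_space"
  assumes E: "is_onb E"
  shows "((\<lambda>e. cinner e x *\<^sub>C e) has_sum x) E"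
proof -
  have on: "orthonormal E" and dense: "closure (cspan E) = UNIV"
    using E by (auto simp: is_onb_iff)
  define P :: "'a set \<Rightarrow> 'a \<Rightarrow> 'a" where "P G y = (\<Sum>e\<in>G. cinner e y *\<^sub>C e)" for G y
  have P_lin: "P G (c *\<^sub>C y + z) = c *\<^sub>C P G y + P G z" for G c y z
    by (simp add: P_def cinner_simps scaleC_add_left sum.distrib scaleC.scale_sum_right scaleC_scaleC)
  have fin: "\<forall>\<^sub>F G in finite_subsets_at_top E. finite G \<and> G \<subseteq> E"
    by (auto intro: eventually_finite_subsets_at_top_weakI)
  have ev: "\<forall>\<^sub>F G in finite_subsets_at_top E. P G v = v" if "v \<in> cspan E" for v
    using that
  proof (induction rule: scaleC.span_induct_alt)
    case base
    then show ?case by (simp add: P_def)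
  next
    case (step c e y)
    have "P G e = e" if "finite G" "G \<subseteq> E" "e \<in> G" for G
    proof -
      have "P G e = (\<Sum>f\<in>G. if f = e then e else 0)"
        unfolding P_def using that on
        by (intro sum.cong) (auto simp: orthonormal_def cinner_self subset_iff)
      then show ?thesis
        using that by simp
    qed
    then have "\<forall>\<^sub>F G in finite_subsets_at_top E. P G e = e"
      using step(1) by (auto simp: eventually_finite_subsets_at_top intro!: exI[of _ "{e}"])
    with step(2) show ?case
      by eventually_elim (simp add: P_lin)
  qed
  have "\<forall>\<^sub>F G in finite_subsets_at_top E. dist (P G x) x < \<epsilon>" if "\<epsilon> > 0" for \<epsilon>
  proof -
    obtain v where v: "v \<in> cspan E" "dist v x < \<epsilon>"
      using dense \<open>\<epsilon> > 0\<close> by (metis UNIV_I closure_approachable)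
    show ?thesis
      using ev[OF v(1)] fin
    proof eventually_elim
      case (elim G)
      \<comment> \<open>The residual is linear and vanishes at \<open>v\<close> for this
        \<open>G\<close>.\<close>
      have "x - P G x = (x - v) - P G (x - v)"
        using elim P_lin[of G "-1" v x] by (simp add: scaleC.scale_minus_left)
      then have "dist (P G x) x = norm ((x - v) - P G (x - v))"
        by (metis dist_commute dist_norm)
      also have "\<dots> \<le> norm (x - v)"
        unfolding P_def using norm_residual_le on elim by blast
      also have "\<dots> < \<epsilon>"
        using v(2) by (simp add: dist_norm norm_minus_commute)
      finally show ?case .
    qed
  qed
  then show ?thesis
    unfolding has_sum_def tendsto_iff P_def by blast
qed

lemma parseval_cinner:
  assumes "is_onb E"
  shows "((\<lambda>e. cinner y e * cinner e x) has_sum cinner y x) E"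
  using has_sum_bounded_linear[OF bounded_linear_cinner_right onb_expansion[OF assms], of y x]
  by (simp add: cinner_simps mult.commute)

lemma parseval_norm:
  assumes "is_onb E"
  shows "((\<lambda>e. (cmod (cinner e x))\<^sup>2) has_sum (norm x)\<^sup>2) E"
proof -
  have "cinner x e * cinner e x = of_real ((cmod (cinner e x))\<^sup>2)" for e
    by (metis cinner_commute complex_norm_square mult.commute)
  then show ?thesis
    using has_sum_Re[OF parseval_cinner[OF assms, of x x]] by (simp add: cinner_self del: of_real_power)
qed


section \<open>Square-summable families and Hilbert-Schmidt operators\<close>

lemma mult_le_sum_squares: "a * b \<le> a\<^sup>2 + b\<^sup>2" for a b :: real
  using sum_squares_bound[of a b] by (cases "a * b \<ge> 0") (auto intro: order_trans[of _ 0])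

lemma square_summable_cinner:
  assumes u: "(\<lambda>i. (norm (u i))\<^sup>2) summable_on I" and v: "(\<lambda>i. (norm (v i))\<^sup>2) summable_on I"
  shows "(\<lambda>i. cmod (cinner (u i) (v i))) summable_on I"
proof (rule summable_on_comparison_test[OF summable_on_add[OF u v]])
  fix i
  have "norm (u i) * norm (v i) \<le> (norm (u i))\<^sup>2 + (norm (v i))\<^sup>2"
    by (simp add: mult_le_sum_squares)
  then show "norm (cinner (u i) (v i)) \<le> (norm (u i))\<^sup>2 + (norm (v i))\<^sup>2"
    using cmod_cinner_le order_trans by blast
qed simp

text \<open>Cauchy-Schwarz for square-summable families: the finite inequality for
  \<open>L2_set\<close> holds on every finite subset, and absolute summability carries the bound to
  the whole sum.\<close>

lemma infsum_cinner_bound: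
  fixes u v :: "'i \<Rightarrow> 'a::chilbert_space"
  assumes u: "(\<lambda>i. (norm (u i))\<^sup>2) summable_on I" "(\<Sum>\<^sub>\<infinity>i\<in>I. (norm (u i))\<^sup>2) \<le> a\<^sup>2" "a \<ge> 0"
    and v: "(\<lambda>i. (norm (v i))\<^sup>2) summable_on I" "(\<Sum>\<^sub>\<infinity>i\<in>I. (norm (v i))\<^sup>2) \<le> b\<^sup>2" "b \<ge> 0"
  shows "cmod (\<Sum>\<^sub>\<infinity>i\<in>I. cinner (u i) (v i)) \<le> a * b"
proof -
  note abs = square_summable_cinner[OF u(1) v(1)]
  have "(\<Sum>i\<in>F. cmod (cinner (u i) (v i))) \<le> a * b" if F: "finite F" "F \<subseteq> I" for F
  proof -
    have L2: "L2_set (\<lambda>i. norm (w i)) F \<le> c"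
      if "(\<lambda>i. (norm (w i))\<^sup>2) summable_on I" "(\<Sum>\<^sub>\<infinity>i\<in>I. (norm (w i))\<^sup>2) \<le> c\<^sup>2" "c \<ge> 0"
      for w :: "'i \<Rightarrow> 'a" and c
      unfolding L2_set_def using finite_sum_le_infsum[OF that(1) F] that
      by (intro real_le_lsqrt) (auto intro: sum_nonneg order_trans)
    have "(\<Sum>i\<in>F. cmod (cinner (u i) (v i))) \<le> (\<Sum>i\<in>F. \<bar>norm (u i)\<bar> * \<bar>norm (v i)\<bar>)"
      by (intro sum_mono) (simp add: cmod_cinner_le)
    also have "\<dots> \<le> L2_set (\<lambda>i. norm (u i)) F * L2_set (\<lambda>i. norm (v i)) F"
      by (rule L2_set_mult_ineq)
    also have "\<dots> \<le> a * b"
      using u v by (intro mult_mono L2) (auto simp: L2_set_def sum_nonneg)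
    finally show ?thesis .
  qed
  then have "(\<Sum>\<^sub>\<infinity>i\<in>I. cmod (cinner (u i) (v i))) \<le> a * b"
    using abs by (intro infsum_le_finite_sums)
  with norm_infsum_bound[OF abs] show ?thesis
    by simp
qed

lemma square_summable_bounded_linear:
  assumes A: "bounded_linear A" and u: "(\<lambda>i. (norm (u i))\<^sup>2) summable_on I"
  shows "(\<lambda>i. (norm (A (u i)))\<^sup>2) summable_on I"
    and "(\<Sum>\<^sub>\<infinity>i\<in>I. (norm (A (u i)))\<^sup>2) \<le> (onorm A)\<^sup>2 * (\<Sum>\<^sub>\<infinity>i\<in>I. (norm (u i))\<^sup>2)"
proof -
  have le: "(norm (A (u i)))\<^sup>2 \<le> (onorm A)\<^sup>2 * (norm (u i))\<^sup>2" for i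
    using power_mono[OF onorm[OF A, of "u i"], of 2] by (simp add: power_mult_distrib)
  note u' = summable_on_cmult_right[OF u, of "(onorm A)\<^sup>2"]
  show sum: "(\<lambda>i. (norm (A (u i)))\<^sup>2) summable_on I"
    by (rule summable_on_comparison_test[OF u']) (use le in auto)
  show "(\<Sum>\<^sub>\<infinity>i\<in>I. (norm (A (u i)))\<^sup>2) \<le> (onorm A)\<^sup>2 * (\<Sum>\<^sub>\<infinity>i\<in>I. (norm (u i))\<^sup>2)"
    using infsum_mono[OF sum u' le] by (simp add: infsum_cmult_right')
qed

text \<open>Cyclicity of the trace, for M composed with the adjoint of N. The double family
  \<open>g\<close> is summed in two orders: over \<open>F\<close> first, Parseval gives
  \<open>cinner (N e) (M e)\<close>; over \<open>E\<close> first, both operators pass to their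
  adjoints and Parseval in the domain applies. Fubini is justified since each term is at most the
  sum of the squared matrix entries of M and N.\<close>

lemma hilbert_schmidt_swap:
  fixes M N :: "'a::chilbert_space \<Rightarrow> 'b::chilbert_space"
  assumes E: "is_onb E" and F: "is_onb F"
    and M: "bounded_clinear M" "(\<lambda>e. (norm (M e))\<^sup>2) summable_on E"
    and N: "bounded_clinear N" "(\<lambda>e. (norm (N e))\<^sup>2) summable_on E"
  shows "((\<lambda>f. cinner (cadjoint M f) (cadjoint N f)) has_sum (\<Sum>\<^sub>\<infinity>e\<in>E. cinner (N e) (M e))) F"
proof -
  define g where "g = (\<lambda>(e, f). cinner (N e) f * cinner f (M e))"
  have HS: "(\<lambda>(e, f). (cmod (cinner f (L e)))\<^sup>2) summable_on E \<times> F"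
    if "(\<lambda>e. (norm (L e))\<^sup>2) summable_on E" for L :: "'a \<Rightarrow> 'b"
    by (rule summable_on_SigmaI[where g = "\<lambda>e. (norm (L e))\<^sup>2"])
      (use parseval_norm[OF F] that in auto)
  have "(\<lambda>x. cmod (g x)) summable_on E \<times> F"
  proof (rule summable_on_comparison_test[OF summable_on_add[OF HS[OF N(2)] HS[OF M(2)]]])
    fix x :: "'a \<times> 'b"
    obtain e f where x: "x = (e, f)"
      by fastforce
    have "cmod (cinner (N e) f) = cmod (cinner f (N e))"
      by (metis cinner_commute complex_mod_cnj)
    then show "norm (g x) \<le> (case x of (e, f) \<Rightarrow> (cmod (cinner f (N e)))\<^sup>2)
        + (case x of (e, f) \<Rightarrow> (cmod (cinner f (M e)))\<^sup>2)"
      by (simp add: x g_def norm_mult mult_le_sum_squares)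
  qed simp
  then have g: "(g has_sum infsum g (E \<times> F)) (E \<times> F)"
    by (rule has_sum_infsum[OF abs_summable_summable])
  have "((\<lambda>e. cinner (N e) (M e)) has_sum infsum g (E \<times> F)) E"
    by (rule has_sum_SigmaD[OF g]) (simp add: g_def parseval_cinner[OF F])
  then have "(\<Sum>\<^sub>\<infinity>e\<in>E. cinner (N e) (M e)) = infsum g (E \<times> F)"
    by (rule infsumI)
  moreover have "((\<lambda>f. cinner (cadjoint M f) (cadjoint N f)) has_sum infsum g (E \<times> F)) F"
  proof (rule has_sum_SigmaD[OF g[unfolded has_sum_swap[of g]]])
    fix f
    have "(case (f, e) of (x, y) \<Rightarrow> g (y, x)) = cinner (cadjoint M f) e * cinner e (cadjoint N f)" for e
      by (simp add: g_def cinner_cadjoint_left[OF M(1)] cinner_cadjoint_right[OF N(1)])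
    then show "((\<lambda>e. case (f, e) of (x, y) \<Rightarrow> g (y, x)) has_sum cinner (cadjoint M f) (cadjoint N f)) E"
      using parseval_cinner[OF E, of "cadjoint M f" "cadjoint N f"] by presburger
  qed
  ultimately show ?thesis
    by simp
qed


section \<open>Square roots of positive operators\<close>

text \<open>The square root is built as a limit of merely real-linear \<open>blinfun\<close>
  operators; symmetry for the complex inner product restores complex linearity.\<close>

lemma bounded_clinear_symmetric:
  assumes "bounded_linear S" and "\<And>x y. cinner (S x) y = cinner x (S y)"
  shows "bounded_clinear S"
proof -
  have "S (c *\<^sub>C x) = c *\<^sub>C S x" for c x
    by (rule cinner_extI) (simp add: assms(2) cinner_scaleC_left)
  with assms(1) show ?thesis
    by (simp add: bounded_clinear_iff_bounded_linear)
qed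

text \<open>
  The fixed points of \<open>Y \<mapsto> (X + Y\<^sup>2) / 2\<close> are the solutions of \<open>(1 - Y)\<^sup>2 = 1 - X\<close>. For
  \<open>norm X \<le> 1\<close> the increments of the iteration are dominated in norm by those of the scalar
  iteration at \<open>X = 1\<close>.
\<close>

primrec sqrt_iter :: "('a::real_normed_vector \<Rightarrow>\<^sub>L 'a) \<Rightarrow> nat \<Rightarrow> 'a \<Rightarrow>\<^sub>L 'a" where
  "sqrt_iter X 0 = 0"
| "sqrt_iter X (Suc n) = (1/2) *\<^sub>R (X + (sqrt_iter X n o\<^sub>L sqrt_iter X n))"

primrec sqrt_majorant :: "nat \<Rightarrow> real" where
  "sqrt_majorant 0 = 0"
| "sqrt_majorant (Suc n) = (1 + (sqrt_majorant n)\<^sup>2) / 2"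

lemma sqrt_majorant_bounds: "0 \<le> sqrt_majorant n" "sqrt_majorant n \<le> 1"
  by (induction n) (auto simp: power_le_one)

text \<open>For the value q at \<open>n\<close> the increment is half of the square of q -
  1.\<close>

lemma sqrt_majorant_mono: "sqrt_majorant n \<le> sqrt_majorant (Suc n)"
  using zero_le_power2[of "sqrt_majorant n - 1"] by (simp add: power2_diff)

lemma norm_sqrt_iter_le:
  assumes X: "norm X \<le> 1"
  shows "norm (sqrt_iter X n) \<le> sqrt_majorant n"
proof (induction n)
  case (Suc n)
  have "norm (sqrt_iter X n o\<^sub>L sqrt_iter X n) \<le> (sqrt_majorant n)\<^sup>2"
    using norm_blinfun_compose[of "sqrt_iter X n" "sqrt_iter X n"] power_mono[OF Suc, of 2]
    by (simp add: power2_eq_square)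
  with norm_triangle_ineq[of X "sqrt_iter X n o\<^sub>L sqrt_iter X n"] X show ?case
    by simp
qed simp

text \<open>The difference of two squares is split as P (P - Q) + (P - Q) Q, which is valid without
  commutativity. The same split of the scalars \<open>p\<close>, \<open>q\<close> collapses to the
  difference of their squares, so the induction reproduces the majorant exactly.\<close>

lemma norm_sqrt_iter_diff_le:
  assumes X: "norm X \<le> 1"
  shows "norm (sqrt_iter X (Suc n) - sqrt_iter X n) \<le> sqrt_majorant (Suc n) - sqrt_majorant n"
proof (induction n)
  case 0
  then show ?case using X by simp
next
  case (Suc n)
  define P Q where "P = sqrt_iter X (Suc n)" and "Q = sqrt_iter X n"
  define p q where "p = sqrt_majorant (Suc n)" and "q = sqrt_majorant n"
  have "sqrt_iter X (Suc (Suc n)) - sqrt_iter X (Suc n)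
      = (1/2) *\<^sub>R (X + (P o\<^sub>L P)) - (1/2) *\<^sub>R (X + (Q o\<^sub>L Q))"
    by (simp add: P_def Q_def)
  also have "\<dots> = (1/2) *\<^sub>R ((P o\<^sub>L (P - Q)) + ((P - Q) o\<^sub>L Q))"
    by (rule blinfun_eqI) (simp add: blinfun.bilinear_simps algebra_simps)
  also have "norm \<dots> \<le> (1/2) * (norm P * norm (P - Q) + norm (P - Q) * norm Q)"
    using norm_triangle_ineq[of "P o\<^sub>L (P - Q)" "(P - Q) o\<^sub>L Q"]
      norm_blinfun_compose[of P "P - Q"] norm_blinfun_compose[of "P - Q" Q] by simp
  also have "\<dots> \<le> (1/2) * (p * (p - q) + (p - q) * q)"
    using Suc norm_sqrt_iter_le[OF X, of n] norm_sqrt_iter_le[OF X, of "Suc n"]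
      sqrt_majorant_bounds(1)[of "Suc n"] sqrt_majorant_mono[of n]
    unfolding P_def[symmetric] Q_def[symmetric] p_def[symmetric] q_def[symmetric]
    by (intro mult_left_mono add_mono mult_mono) auto
  also have "\<dots> = (1 + p\<^sup>2) / 2 - (1 + q\<^sup>2) / 2"
    by (simp add: power2_eq_square algebra_simps)
  also have "\<dots> = sqrt_majorant (Suc (Suc n)) - sqrt_majorant (Suc n)"
    by (simp add: p_def q_def)
  finally show ?case .
qed

text \<open>On the unit ball the iteration has Lipschitz bound only 1, so convergence is drawn from
  the majorant: it is monotone and bounded, its increments are therefore summable, and they dominate
  those of the operators. Continuity of composition carries the recursion to the limit.\<close>

lemma sqrt_iter_converges:
  fixes X :: "'a::banach \<Rightarrow>\<^sub>L 'a"
  assumes X: "norm X \<le> 1"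
  obtains Y where "sqrt_iter X \<longlonglongrightarrow> Y" "Y = (1/2) *\<^sub>R (X + (Y o\<^sub>L Y))"
proof -
  have "incseq sqrt_majorant"
    by (intro incseq_SucI sqrt_majorant_mono)
  then obtain l where "sqrt_majorant \<longlonglongrightarrow> l"
    by (rule incseq_convergent[where B = 1]) (use sqrt_majorant_bounds(2) in blast)
  then have "summable (\<lambda>n. sqrt_majorant (Suc n) - sqrt_majorant n)"
    by (rule telescope_summable)
  then have "summable (\<lambda>n. sqrt_iter X (Suc n) - sqrt_iter X n)"
    by (rule summable_comparison_test'[where N = 0]) (use norm_sqrt_iter_diff_le[OF X] in blast)
  then have "convergent (\<lambda>n. \<Sum>i<n. sqrt_iter X (Suc i) - sqrt_iter X i)"
    by (simp only: summable_iff_convergent)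
  then obtain Y where Y: "sqrt_iter X \<longlonglongrightarrow> Y"
    by (auto simp only: sum_lessThan_telescope sqrt_iter.simps(1) diff_zero convergent_def)
  have "(\<lambda>n. sqrt_iter X (Suc n)) \<longlonglongrightarrow> (1/2) *\<^sub>R (X + (Y o\<^sub>L Y))"
    unfolding sqrt_iter.simps
    by (intro tendsto_intros bounded_bilinear.tendsto[OF bounded_bilinear_blinfun_compose] Y)
  with LIMSEQ_Suc[OF Y] have "Y = (1/2) *\<^sub>R (X + (Y o\<^sub>L Y))"
    by (rule LIMSEQ_unique)
  with Y show ?thesis
    by (rule that)
qed

text \<open>Every iterate is a polynomial in \<open>X\<close> with real coefficients.\<close>

lemma sqrt_iter_symmetric:
  assumes "\<And>x y. cinner (blinfun_apply X x) y = cinner x (X y)"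
  shows "cinner (sqrt_iter X n x) y = cinner x (sqrt_iter X n y)"
  by (induction n arbitrary: x y) (simp_all add: blinfun.bilinear_simps cinner_simps assms)

lemma symmetric_blinfun_limit:
  fixes Y :: "'a::chilbert_space \<Rightarrow>\<^sub>L 'a"
  assumes lim: "f \<longlonglongrightarrow> Y" and sym: "\<And>n x y. cinner (blinfun_apply (f n) x) y = cinner x (f n y)"
  shows "cinner (Y x) y = cinner x (Y y)"
proof -
  have *: "(\<lambda>n. cinner u (f n v)) \<longlonglongrightarrow> cinner u (Y v)" for u v
    by (intro bounded_linear.tendsto[OF bounded_linear_cinner_right] blinfun.tendsto lim tendsto_const)
  have "(\<lambda>n. cinner x (f n y)) = (\<lambda>n. cnj (cinner y (f n x)))"
    by (metis sym cinner_commute)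
  then have "cinner x (Y y) = cnj (cinner y (Y x))"
    using LIMSEQ_unique[OF *[of x y]] tendsto_cnj[OF *[of y x]] by metis
  then show ?thesis
    by (metis cinner_commute)
qed

text \<open>Polarisation, using only that the quadratic form is real: its value at x + y relates the
  imaginary parts of the two mixed terms, its value at x + i y their real parts.\<close>

lemma positive_op_symmetric:
  assumes "positive_op \<tau>"
  shows "cinner (\<tau> x) y = cinner x (\<tau> y)"
proof -
  have lin: "bounded_clinear \<tau>" and im: "\<And>x. Im (cinner x (\<tau> x)) = 0"
    using assms by (auto simp: positive_op_def complex_nonneg_Reals_iff)
  have "Im (cinner x (\<tau> y)) + Im (cinner y (\<tau> x)) = 0"
    using im[of "x + y"] im[of x] im[of y]
    by (simp add: bounded_clinear_add[OF lin] cinner_simps)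
  moreover have "Re (cinner x (\<tau> y)) = Re (cinner y (\<tau> x))"
    using im[of "x + \<i> *\<^sub>C y"] im[of x] im[of y]
    by (simp add: bounded_clinear_add[OF lin] bounded_clinear_scaleC[OF lin] cinner_simps)
  ultimately have "cinner x (\<tau> y) = cnj (cinner y (\<tau> x))"
    by (simp add: complex_eq_iff)
  then show ?thesis
    by (metis cinner_commute)
qed

text \<open>Dividing by a bound \<open>K\<close> gives an operator \<open>t\<close> between 0 and 1.
  With X = 1 - t the iteration has norm of \<open>X\<close> at most 1, and its limit
  \<open>Y\<close> makes 1 - Y a square root of \<open>t\<close>; the factor \<open>sqrt K\<close>
  undoes the scaling.\<close>

lemma positive_op_sqrt:
  fixes \<tau> :: "'a::chilbert_space \<Rightarrow> 'a"
  assumes \<tau>: "positive_op \<tau>"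
  obtains S where "bounded_clinear S" "\<And>x y. cinner (S x) y = cinner x (S y)" "\<And>x. S (S x) = \<tau> x"
proof -
  have lin: "bounded_linear \<tau>" and pos: "\<And>x. inner x (\<tau> x) \<ge> 0"
    using \<tau> by (auto simp: positive_op_def complex_nonneg_Reals_iff Re_cinner
        bounded_clinear_imp_bounded_linear)
  note sym = positive_op_symmetric[OF \<tau>]
  obtain K where K: "K > 0" "\<And>x. norm (\<tau> x) \<le> norm x * K"
    using bounded_linear.pos_bounded[OF lin] by blast
  define t where "t x = (1/K) *\<^sub>R \<tau> x" for x
  have t_lin: "bounded_linear t"
    unfolding t_def by (intro bounded_linear_const_scaleR lin)
  have t_sym: "cinner (t x) y = cinner x (t y)" for x y
    by (simp add: t_def cinner_simps sym)
  have t_le: "norm (t x) \<le> norm x" for x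
    using K by (simp add: t_def divide_simps mult.commute)
  have t_pos: "inner x (t x) \<ge> 0" for x
    using K(1) pos by (simp add: t_def)
  have t_contr: "norm (x - t x) \<le> norm x" for x
  proof -
    have symi: "inner (t x) y = inner x (t y)" for x y
      by (metis Re_cinner t_sym)
    \<comment> \<open>Positivity of \<open>t\<close> at \<open>x - t x\<close> gives \<open>norm (t x)\<^sup>2 \<le> inner x (t x)\<close>.\<close>
    have "0 \<le> inner (x - t x) (t (x - t x))"
      by (rule t_pos)
    also have "\<dots> = inner x (t x) - 2 * inner (t x) (t x) + inner (t x) (t (t x))"
      by (simp add: linear_diff[OF bounded_linear.linear[OF t_lin]] inner_simps symi)
    also have "inner (t x) (t (t x)) \<le> norm (t x) * norm (t x)"
      using norm_cauchy_schwarz[of "t x" "t (t x)"] mult_left_mono[OF t_le[of "t x"] norm_ge_zero[of "t x"]]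
      by linarith
    also have "\<dots> = inner (t x) (t x)"
      by (simp add: power2_norm_eq_inner flip: power2_eq_square)
    finally have "inner (t x) (t x) \<le> inner x (t x)"
      by simp
    moreover have "(norm (x - t x))\<^sup>2 = (norm x)\<^sup>2 - 2 * inner x (t x) + inner (t x) (t x)"
      by (simp add: power2_norm_eq_inner inner_simps inner_commute)
    ultimately have "(norm (x - t x))\<^sup>2 \<le> (norm x)\<^sup>2"
      using t_pos[of x] by linarith
    then show ?thesis
      by (rule power2_le_imp_le) simp
  qed
  define X where "X = Blinfun (\<lambda>x. x - t x)"
  have X: "blinfun_apply X x = x - t x" for x
    unfolding X_def by (simp add: bounded_linear_Blinfun_apply bounded_linear_sub t_lin)
  have "norm X \<le> 1"
    by (rule norm_blinfun_bound) (auto simp: X t_contr)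
  then obtain Y where Y: "sqrt_iter X \<longlonglongrightarrow> Y" "Y = (1/2) *\<^sub>R (X + (Y o\<^sub>L Y))"
    using sqrt_iter_converges by blast
  have Y_sym: "cinner (Y x) y = cinner x (Y y)" for x y
    by (rule symmetric_blinfun_limit[OF Y(1)], rule sqrt_iter_symmetric)
      (simp add: X cinner_simps t_sym)
  define S where "S x = sqrt K *\<^sub>R (x - Y x)" for x
  have S_lin: "bounded_linear S"
    unfolding S_def
    by (intro bounded_linear_const_scaleR bounded_linear_sub bounded_linear_ident
        blinfun.bounded_linear_right)
  have S_sym: "cinner (S x) y = cinner x (S y)" for x y
    by (simp add: S_def cinner_simps Y_sym)
  have "S (S x) = \<tau> x" for x
  proof -
    have "Y x = (1/2) *\<^sub>R (x - t x + Y (Y x))"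
      using arg_cong[OF Y(2), of "\<lambda>Z. blinfun_apply Z x"]
      by (simp add: blinfun.bilinear_simps X)
    from arg_cong[OF this, of "scaleR 2"] have "2 *\<^sub>R Y x = x - t x + Y (Y x)"
      by simp
    \<comment> \<open>The fixed point equation for X = 1 - t, rearranged: the square of 1 - Y is
      \<open>t\<close>.\<close>
    then have "x - Y x - Y (x - Y x) = t x"
      by (simp add: blinfun.bilinear_simps scaleR_2 algebra_simps)
    then have "S (S x) = K *\<^sub>R t x"
      using K(1) by (simp add: S_def blinfun.bilinear_simps flip: scaleR_diff_right)
    then show ?thesis
      using K(1) by (simp add: t_def)
  qed
  with bounded_clinear_symmetric[OF S_lin S_sym] S_sym show ?thesis
    by (rule that)
qed


section \<open>Tensor products and traces\<close>

lemma bounded_clinear_eq_on_dense: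
  assumes X: "bounded_clinear X" and Y: "bounded_clinear Y"
    and eq: "\<And>v. v \<in> D \<Longrightarrow> X v = Y v" and dense: "closure (cspan D) = UNIV"
  shows "X = Y"
proof
  fix v
  have "X w = Y w" if "w \<in> cspan D" for w
    using that
  proof (induction rule: scaleC.span_induct_alt)
    case base
    then show ?case
      using X Y by (metis bounded_clinear_scaleR scaleR_zero_left)
  next
    case (step c e y)
    then show ?case
      by (simp add: bounded_clinear_add[OF X] bounded_clinear_add[OF Y] bounded_clinear_scaleC[OF X]
          bounded_clinear_scaleC[OF Y] eq)
  qed
  then have "cspan D \<subseteq> {w. X w = Y w}"
    by blast
  moreover have "closed {w. X w = Y w}"
    using X Y by (intro closed_Collect_eq linear_continuous_on bounded_clinear_imp_bounded_linear)
  ultimately have "closure (cspan D) \<subseteq> {w. X w = Y w}"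
    by (rule closure_minimal)
  with dense show "X v = Y v"
    by auto
qed

text \<open>Elementary tensors span a dense subspace, so at most one bounded operator acts on them
  as prescribed. Any explicit candidate therefore evaluates the definite description in
  \<open>tensor_op\<close>.\<close>

lemma tensor_op_eqI:
  assumes tens: "is_hilbert_tensor tens"
    and X: "bounded_clinear X" "\<And>x y. X (tens x y) = tens (R x) (S y)"
  shows "tensor_op tens R S = X"
  unfolding tensor_op_def
proof (rule the_equality)
  fix Y assume Y: "bounded_clinear Y \<and> (\<forall>x y. Y (tens x y) = tens (R x) (S y))"
  have "closure (cspan {tens x y |x y. True}) = UNIV"
    using tens by (simp add: is_hilbert_tensor_def)
  then show "Y = X"
    by (rule bounded_clinear_eq_on_dense[rotated -1]) (use X Y in auto)
qed (use X in blast)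

context
  fixes tens :: "'k::chilbert_space \<Rightarrow> 'h::chilbert_space \<Rightarrow> 'l::chilbert_space"
  assumes tens: "is_hilbert_tensor tens"
begin

lemma tens_add_left: "tens (x + x') y = tens x y + tens x' y"
  and tens_add_right: "tens x (y + y') = tens x y + tens x y'"
  and tens_scaleC_left: "tens (c *\<^sub>C x) y = c *\<^sub>C tens x y"
  and tens_scaleC_right: "tens x (c *\<^sub>C y) = c *\<^sub>C tens x y"
  and cinner_tens: "cinner (tens x y) (tens x' y') = cinner x x' * cinner y y'"
  using tens by (simp_all add: is_hilbert_tensor_def clinear_iff)

lemma tens_scaleR_right: "tens x (r *\<^sub>R y) = r *\<^sub>R tens x y"
  by (metis tens_scaleC_right scaleC_of_real)

lemma norm_tens: "norm (tens x y) = norm x * norm y"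
proof -
  have "complex_of_real ((norm (tens x y))\<^sup>2) = of_real ((norm x * norm y)\<^sup>2)"
    by (metis cinner_self cinner_tens of_real_mult power_mult_distrib)
  then show ?thesis
    by (metis of_real_eq_iff mult_nonneg_nonneg norm_ge_zero power2_eq_imp_eq)
qed

lemma bounded_clinear_tens_left: "bounded_clinear (\<lambda>x. tens x y)"
  unfolding bounded_clinear_def clinear_iff
  by (auto simp: tens_add_left tens_scaleC_left norm_tens)

text \<open>The adjoint of tensoring with \<psi> contracts the second factor against \<psi>.
  Tensoring again with \<psi> thus produces the rank one projection in that factor.\<close>

lemma cadjoint_tens_left: "cadjoint (\<lambda>x. tens x \<psi>) (tens x y) = cinner \<psi> y *\<^sub>C x"
  by (rule cinner_extI, subst cinner_commute)
    (simp add: cinner_cadjoint_right[OF bounded_clinear_tens_left] cinner_tens cinner_simps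
      cinner_commute[of x] cinner_commute[of y] mult.commute)

text \<open>With V denoting the map that tensors with \<psi>, this is V \<tau> V*: a composition of
  bounded maps, hence a candidate for the tensor operator whose boundedness is immediate.\<close>

definition tensor_rank_one :: "('k \<Rightarrow> 'k) \<Rightarrow> 'h \<Rightarrow> 'l \<Rightarrow> 'l"
  where "tensor_rank_one \<tau> \<psi> = (\<lambda>v. tens (\<tau> (cadjoint (\<lambda>x. tens x \<psi>) v)) \<psi>)"

lemma bounded_clinear_tensor_rank_one:
  assumes "bounded_clinear \<tau>"
  shows "bounded_clinear (tensor_rank_one \<tau> \<psi>)"
  unfolding tensor_rank_one_def
  by (rule bounded_clinear_compose[OF bounded_clinear_tens_left bounded_clinear_compose
        [OF assms bounded_clinear_cadjoint[OF bounded_clinear_tens_left]]])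

lemma tensor_rank_one_tens:
  "bounded_clinear \<tau> \<Longrightarrow> tensor_rank_one \<tau> \<psi> (tens x y) = tens (\<tau> x) (rank_one_proj \<psi> y)"
  by (simp add: tensor_rank_one_def cadjoint_tens_left rank_one_proj_def tens_scaleC_left
      tens_scaleC_right bounded_clinear_scaleC)

lemma tensor_op_rank_one:
  "bounded_clinear \<tau> \<Longrightarrow> tensor_op tens \<tau> (rank_one_proj \<psi>) = tensor_rank_one \<tau> \<psi>"
  by (intro tensor_op_eqI[OF tens] bounded_clinear_tensor_rank_one tensor_rank_one_tens)

text \<open>A mixture is in general not of rank one, so it gets its own candidate, the same real
  combination of the two rank one candidates; they agree on elementary tensors because
  \<open>tens\<close> is additive in its second argument.\<close>

lemma tensor_op_mixture:
  assumes "bounded_clinear \<tau>"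
  shows "tensor_op tens \<tau> (\<lambda>x. p *\<^sub>R rank_one_proj \<psi> x + q *\<^sub>R rank_one_proj \<phi> x)
    = (\<lambda>v. p *\<^sub>R tensor_rank_one \<tau> \<psi> v + q *\<^sub>R tensor_rank_one \<tau> \<phi> v)"
  by (intro tensor_op_eqI[OF tens] bounded_clinear_sum bounded_clinear_scaleR_comp
      bounded_clinear_tensor_rank_one assms)
    (simp add: tensor_rank_one_tens[OF assms] tens_add_right tens_scaleR_right)

end

text \<open>Cyclicity is applied to M = W S and to N, the adjoint of \<open>A\<close> after M. This
  N is chosen so that its adjoint is S W* A, which places \<open>A\<close> at the right end of the
  trace on one side and between the two copies of W S e on the other. Summability over
  \<open>F\<close> is part of the conclusion, whatever basis \<open>F\<close> is.\<close>

lemma trace_conjugated_square: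
  fixes W :: "'k::chilbert_space \<Rightarrow> 'l::chilbert_space"
  assumes S: "bounded_clinear S" "\<And>x y. cinner (S x) y = cinner x (S y)"
    and W: "bounded_clinear W" and A: "bounded_clinear A"
    and E: "is_onb E" and F: "is_onb F"
    and HS: "(\<lambda>e. (norm (S e))\<^sup>2) summable_on E"
  shows "((\<lambda>f. cinner f (W (S (S (cadjoint W (A f))))))
    has_sum (\<Sum>\<^sub>\<infinity>e\<in>E. cinner (W (S e)) (A (W (S e))))) F"
proof -
  define M N where M_def: "M = (\<lambda>x. W (S x))" and N_def: "N = (\<lambda>x. cadjoint A (M x))"
  have M: "bounded_clinear M"
    unfolding M_def by (rule bounded_clinear_compose[OF W S(1)])
  have N: "bounded_clinear N"
    unfolding N_def by (rule bounded_clinear_compose[OF bounded_clinear_cadjoint[OF A] M])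
  have M_sum: "(\<lambda>e. (norm (M e))\<^sup>2) summable_on E"
    unfolding M_def
    by (rule square_summable_bounded_linear(1)[OF bounded_clinear_imp_bounded_linear[OF W] HS])
  have N_sum: "(\<lambda>e. (norm (N e))\<^sup>2) summable_on E"
    unfolding N_def
    by (rule square_summable_bounded_linear(1)
        [OF bounded_clinear_imp_bounded_linear[OF bounded_clinear_cadjoint[OF A]] M_sum])
  have M_adj: "cadjoint M f = S (cadjoint W f)" for f
    by (rule cinner_extI)
      (simp add: cinner_cadjoint_left[OF M] S(2) cinner_cadjoint_left[OF W], simp add: M_def)
  have N_adj: "cadjoint N f = S (cadjoint W (A f))" for f
    by (rule cinner_extI)
      (simp add: cinner_cadjoint_left[OF N] S(2) cinner_cadjoint_left[OF W],
        simp add: N_def cinner_cadjoint_right[OF A] M_def)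
  have "cinner (cadjoint M f) (cadjoint N f) = cinner f (W (S (S (cadjoint W (A f)))))" for f
    unfolding M_adj N_adj by (simp add: S(2) cinner_cadjoint_left[OF W])
  moreover have "cinner (N e) (M e) = cinner (W (S e)) (A (W (S e)))" for e
    by (simp add: N_def cinner_cadjoint_left[OF A], simp add: M_def)
  ultimately show ?thesis
    using hilbert_schmidt_swap[OF E F M M_sum N N_sum] by simp
qed


section \<open>The cross term\<close>

text \<open>Expanding the square gives the second moment, -2 b times the mean b, and the square of b
  times the total weight 1.\<close>

lemma variance_has_sum:
  fixes \<phi> :: "'i \<Rightarrow> 'a::chilbert_space"
  assumes B: "bounded_clinear B"
    and \<phi>: "((\<lambda>i. (norm (\<phi> i))\<^sup>2) has_sum 1) I"
    and b: "b = Re (\<Sum>\<^sub>\<infinity>i\<in>I. cinner (\<phi> i) (B (\<phi> i)))"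
  shows "((\<lambda>i. (norm (B (\<phi> i) - b *\<^sub>R \<phi> i))\<^sup>2) has_sum
    ((\<Sum>\<^sub>\<infinity>i\<in>I. (norm (B (\<phi> i)))\<^sup>2) - b\<^sup>2)) I"
proof -
  note \<phi>_sum = has_sum_imp_summable[OF \<phi>]
  note B_sum = square_summable_bounded_linear(1)[OF bounded_clinear_imp_bounded_linear[OF B] \<phi>_sum]
  have "((\<lambda>i. cinner (\<phi> i) (B (\<phi> i))) has_sum (\<Sum>\<^sub>\<infinity>i\<in>I. cinner (\<phi> i) (B (\<phi> i)))) I"
    by (rule has_sum_infsum[OF abs_summable_summable[OF square_summable_cinner[OF \<phi>_sum B_sum]]])
  from has_sum_Re[OF this] have "((\<lambda>i. inner (\<phi> i) (B (\<phi> i))) has_sum b) I"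
    by (simp add: b Re_cinner)
  then have "((\<lambda>i. (norm (B (\<phi> i)))\<^sup>2 + (- 2 * b) * inner (\<phi> i) (B (\<phi> i)) + b\<^sup>2 * (norm (\<phi> i))\<^sup>2)
      has_sum ((\<Sum>\<^sub>\<infinity>i\<in>I. (norm (B (\<phi> i)))\<^sup>2) + (- 2 * b) * b + b\<^sup>2 * 1)) I"
    by (intro has_sum_add has_sum_cmult_right has_sum_infsum B_sum \<phi>)
  moreover have "(norm (B x - b *\<^sub>R x))\<^sup>2
      = (norm (B x))\<^sup>2 + (- 2 * b) * inner x (B x) + b\<^sup>2 * (norm x)\<^sup>2" for x
    by (simp add: power2_norm_eq_inner inner_simps inner_commute)
      (simp add: power2_eq_square algebra_simps)
  ultimately show ?thesis
    by (simp add: power2_eq_square)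
qed

lemma cross_term_bound:
  fixes \<phi>\<^sub>0 \<phi>\<^sub>1 :: "'i \<Rightarrow> 'a::chilbert_space"
  assumes A: "bounded_clinear A" and B: "bounded_clinear B"
    and A_sym: "\<And>x y. cinner (A x) y = cinner x (A y)"
    and B_sym: "\<And>x y. cinner (B x) y = cinner x (B y)"
    and \<phi>\<^sub>0: "((\<lambda>i. (norm (\<phi>\<^sub>0 i))\<^sup>2) has_sum 1) I"
    and \<phi>\<^sub>1: "((\<lambda>i. (norm (\<phi>\<^sub>1 i))\<^sup>2) has_sum 1) I"
    and b\<^sub>0: "b\<^sub>0 = Re (\<Sum>\<^sub>\<infinity>i\<in>I. cinner (\<phi>\<^sub>0 i) (B (\<phi>\<^sub>0 i)))"
    and b\<^sub>1: "b\<^sub>1 = Re (\<Sum>\<^sub>\<infinity>i\<in>I. cinner (\<phi>\<^sub>1 i) (B (\<phi>\<^sub>1 i)))"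
    and \<sigma>\<^sub>0: "\<sigma>\<^sub>0 = sqrt ((\<Sum>\<^sub>\<infinity>i\<in>I. (norm (B (\<phi>\<^sub>0 i)))\<^sup>2) - b\<^sub>0\<^sup>2)"
    and \<sigma>\<^sub>1: "\<sigma>\<^sub>1 = sqrt ((\<Sum>\<^sub>\<infinity>i\<in>I. (norm (B (\<phi>\<^sub>1 i)))\<^sup>2) - b\<^sub>1\<^sup>2)"
  shows "\<bar>b\<^sub>0 - b\<^sub>1\<bar> * cmod (\<Sum>\<^sub>\<infinity>i\<in>I. cinner (\<phi>\<^sub>0 i) (A (\<phi>\<^sub>1 i)))
    \<le> onorm (commutator A B) + (\<sigma>\<^sub>0 + \<sigma>\<^sub>1) * onorm A"
proof -
  define u\<^sub>0 u\<^sub>1 where "u\<^sub>0 i = B (\<phi>\<^sub>0 i) - b\<^sub>0 *\<^sub>R \<phi>\<^sub>0 i" and "u\<^sub>1 i = B (\<phi>\<^sub>1 i) - b\<^sub>1 *\<^sub>R \<phi>\<^sub>1 i" for i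
  note blA = bounded_clinear_imp_bounded_linear[OF A] and blB = bounded_clinear_imp_bounded_linear[OF B]
  have blC: "bounded_linear (commutator A B)"
    unfolding commutator_def
    by (intro bounded_linear_sub bounded_linear_compose[OF blA] bounded_linear_compose[OF blB] blA blB)
  have var: "((\<lambda>i. (norm (u\<^sub>0 i))\<^sup>2) has_sum ((\<Sum>\<^sub>\<infinity>i\<in>I. (norm (B (\<phi>\<^sub>0 i)))\<^sup>2) - b\<^sub>0\<^sup>2)) I"
    "((\<lambda>i. (norm (u\<^sub>1 i))\<^sup>2) has_sum ((\<Sum>\<^sub>\<infinity>i\<in>I. (norm (B (\<phi>\<^sub>1 i)))\<^sup>2) - b\<^sub>1\<^sup>2)) I"
    unfolding u\<^sub>0_def u\<^sub>1_def by (rule variance_has_sum[OF B \<phi>\<^sub>0 b\<^sub>0] variance_has_sum[OF B \<phi>\<^sub>1 b\<^sub>1])+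
  \<comment> \<open>The radicands are sums of squares, hence nonnegative, so squaring
    \<open>\<sigma>\<^sub>0\<close> and \<open>\<sigma>\<^sub>1\<close> does recover the
    variances.\<close>
  have \<sigma>: "\<sigma>\<^sub>0 \<ge> 0" "\<sigma>\<^sub>1 \<ge> 0"
    and u: "((\<lambda>i. (norm (u\<^sub>0 i))\<^sup>2) has_sum \<sigma>\<^sub>0\<^sup>2) I" "((\<lambda>i. (norm (u\<^sub>1 i))\<^sup>2) has_sum \<sigma>\<^sub>1\<^sup>2) I"
    using var has_sum_nonneg[OF var(1)] has_sum_nonneg[OF var(2)] by (simp_all add: \<sigma>\<^sub>0 \<sigma>\<^sub>1)
  have image: "(\<lambda>i. (norm (L (v i)))\<^sup>2) summable_on I \<and>
      (\<Sum>\<^sub>\<infinity>i\<in>I. (norm (L (v i)))\<^sup>2) \<le> (onorm L * c)\<^sup>2"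
    if "bounded_linear L" "((\<lambda>i. (norm (v i))\<^sup>2) has_sum c\<^sup>2) I" for L :: "'a \<Rightarrow> 'a" and v c
    using square_summable_bounded_linear[OF that(1) has_sum_imp_summable[OF that(2)]] infsumI[OF that(2)]
    by (simp add: power_mult_distrib)
  have bound: "cmod (\<Sum>\<^sub>\<infinity>i\<in>I. cinner (w i) (L (v i))) \<le> d * (onorm L * c)"
    and summable: "(\<lambda>i. cinner (w i) (L (v i))) summable_on I"
    if "bounded_linear L" "((\<lambda>i. (norm (w i))\<^sup>2) has_sum d\<^sup>2) I" "d \<ge> 0"
      "((\<lambda>i. (norm (v i))\<^sup>2) has_sum c\<^sup>2) I" "c \<ge> 0" for L :: "'a \<Rightarrow> 'a" and v c w d
  proof -
    note w = has_sum_imp_summable[OF that(2)] and Lv = image[OF that(1,4)]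
    show "cmod (\<Sum>\<^sub>\<infinity>i\<in>I. cinner (w i) (L (v i))) \<le> d * (onorm L * c)"
      using Lv that infsumI[OF that(2)] onorm_pos_le[OF that(1)]
      by (intro infsum_cinner_bound w) auto
    show "(\<lambda>i. cinner (w i) (L (v i))) summable_on I"
      using Lv by (intro abs_summable_summable[OF square_summable_cinner[OF w]]) auto
  qed
  have one: "((\<lambda>i. (norm (\<phi>\<^sub>0 i))\<^sup>2) has_sum 1\<^sup>2) I" "((\<lambda>i. (norm (\<phi>\<^sub>1 i))\<^sup>2) has_sum 1\<^sup>2) I"
    using \<phi>\<^sub>0 \<phi>\<^sub>1 by simp_all
  define D C P Q where "D = (\<Sum>\<^sub>\<infinity>i\<in>I. cinner (\<phi>\<^sub>0 i) (A (\<phi>\<^sub>1 i)))"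
    and "C = (\<Sum>\<^sub>\<infinity>i\<in>I. cinner (\<phi>\<^sub>0 i) (commutator A B (\<phi>\<^sub>1 i)))"
    and "P = (\<Sum>\<^sub>\<infinity>i\<in>I. cinner (u\<^sub>0 i) (A (\<phi>\<^sub>1 i)))"
    and "Q = (\<Sum>\<^sub>\<infinity>i\<in>I. cinner (\<phi>\<^sub>0 i) (A (u\<^sub>1 i)))"
  have hD: "((\<lambda>i. cinner (\<phi>\<^sub>0 i) (A (\<phi>\<^sub>1 i))) has_sum D) I"
    and hC: "((\<lambda>i. cinner (\<phi>\<^sub>0 i) (commutator A B (\<phi>\<^sub>1 i))) has_sum C) I"
    and hP: "((\<lambda>i. cinner (u\<^sub>0 i) (A (\<phi>\<^sub>1 i))) has_sum P) I"
    and hQ: "((\<lambda>i. cinner (\<phi>\<^sub>0 i) (A (u\<^sub>1 i))) has_sum Q) I"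
    unfolding D_def C_def P_def Q_def
    by (intro has_sum_infsum summable[OF blA one(1) _ one(2)] summable[OF blC one(1) _ one(2)]
        summable[OF blA u(1) _ one(2)] summable[OF blA one(1) _ u(2)] \<sigma> zero_le_one)+
  \<comment> \<open>Symmetry of \<open>B\<close> moves it off \<open>\<phi>\<^sub>0\<close> in the
    second term, where it cancels the B A half of the commutator; the \<open>b\<^sub>0\<close> terms
    cancel as well.\<close>
  have "of_real (b\<^sub>0 - b\<^sub>1) * cinner (\<phi>\<^sub>0 i) (A (\<phi>\<^sub>1 i)) + cinner (u\<^sub>0 i) (A (\<phi>\<^sub>1 i))
      + cinner (\<phi>\<^sub>0 i) (commutator A B (\<phi>\<^sub>1 i)) = cinner (\<phi>\<^sub>0 i) (A (u\<^sub>1 i))" for i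
    by (simp add: u\<^sub>0_def u\<^sub>1_def commutator_def cinner_simps B_sym linear_diff[OF bounded_linear.linear[OF blA]]
        bounded_clinear_scaleR[OF A] algebra_simps)
  with has_sum_add[OF has_sum_add[OF has_sum_cmult_right[OF hD, of "of_real (b\<^sub>0 - b\<^sub>1)"] hP] hC]
  have "((\<lambda>i. cinner (\<phi>\<^sub>0 i) (A (u\<^sub>1 i))) has_sum (of_real (b\<^sub>0 - b\<^sub>1) * D + P + C)) I"
    by simp
  with hQ have "of_real (b\<^sub>0 - b\<^sub>1) * D + P + C = Q"
    by (metis has_sum_unique)
  then have "of_real (b\<^sub>0 - b\<^sub>1) * D = Q - P - C"
    by (simp add: algebra_simps)
  then have "\<bar>b\<^sub>0 - b\<^sub>1\<bar> * cmod D = cmod (Q - P - C)"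
    by (metis norm_mult norm_of_real)
  also have "\<dots> \<le> cmod Q + cmod P + cmod C"
    by (meson norm_triangle_ineq4 order_trans add_right_mono)
  also have "\<dots> \<le> 1 * (onorm A * \<sigma>\<^sub>1) + \<sigma>\<^sub>0 * (onorm A * 1) + 1 * (onorm (commutator A B) * 1)"
    unfolding Q_def P_def C_def
    by (intro add_mono bound[OF blA one(1) _ u(2)] bound[OF blA u(1) _ one(2)]
        bound[OF blC one(1) _ one(2)] \<sigma> zero_le_one)
  finally show ?thesis
    by (simp add: D_def algebra_simps)
qed


text \<open>The diagonal terms of the expanded quadratic form cancel against the mixture.
  Self-adjointness of \<open>A\<close> makes the two cross terms complex conjugates, so at most
  \<open>2 * cmod \<alpha>\<^sub>0 * cmod \<alpha>\<^sub>1\<close> times the modulus of one remains,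
  and normalisation bounds that factor by 1.\<close>

lemma superposition_defect:
  fixes \<phi>\<^sub>0 \<phi>\<^sub>1 :: "'i \<Rightarrow> 'a::chilbert_space"
  assumes A: "bounded_clinear A" and A_sym: "\<And>x y. cinner (A x) y = cinner x (A y)"
    and \<phi>\<^sub>0: "(\<lambda>i. (norm (\<phi>\<^sub>0 i))\<^sup>2) summable_on I"
    and \<phi>\<^sub>1: "(\<lambda>i. (norm (\<phi>\<^sub>1 i))\<^sup>2) summable_on I"
    and \<alpha>: "(cmod \<alpha>\<^sub>0)\<^sup>2 + (cmod \<alpha>\<^sub>1)\<^sup>2 = 1"
    and \<phi>: "\<And>i. \<phi> i = \<alpha>\<^sub>0 *\<^sub>C \<phi>\<^sub>0 i + \<alpha>\<^sub>1 *\<^sub>C \<phi>\<^sub>1 i"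
  shows "cmod ((\<Sum>\<^sub>\<infinity>i\<in>I. cinner (\<phi> i) (A (\<phi> i)))
      - ((cmod \<alpha>\<^sub>0)\<^sup>2 * (\<Sum>\<^sub>\<infinity>i\<in>I. cinner (\<phi>\<^sub>0 i) (A (\<phi>\<^sub>0 i)))
        + (cmod \<alpha>\<^sub>1)\<^sup>2 * (\<Sum>\<^sub>\<infinity>i\<in>I. cinner (\<phi>\<^sub>1 i) (A (\<phi>\<^sub>1 i)))))
    \<le> cmod (\<Sum>\<^sub>\<infinity>i\<in>I. cinner (\<phi>\<^sub>0 i) (A (\<phi>\<^sub>1 i)))"
proof -
  have summable: "((\<lambda>i. cinner (u i) (A (v i))) has_sum (\<Sum>\<^sub>\<infinity>i\<in>I. cinner (u i) (A (v i)))) I"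
    if "(\<lambda>i. (norm (u i))\<^sup>2) summable_on I" "(\<lambda>i. (norm (v i))\<^sup>2) summable_on I" for u v :: "'i \<Rightarrow> 'a"
    by (rule has_sum_infsum[OF abs_summable_summable[OF square_summable_cinner[OF that(1)
      square_summable_bounded_linear(1)[OF bounded_clinear_imp_bounded_linear[OF A] that(2)]]]])
  define q\<^sub>0 q\<^sub>1 D where "q\<^sub>0 = (\<Sum>\<^sub>\<infinity>i\<in>I. cinner (\<phi>\<^sub>0 i) (A (\<phi>\<^sub>0 i)))"
    and "q\<^sub>1 = (\<Sum>\<^sub>\<infinity>i\<in>I. cinner (\<phi>\<^sub>1 i) (A (\<phi>\<^sub>1 i)))"
    and "D = (\<Sum>\<^sub>\<infinity>i\<in>I. cinner (\<phi>\<^sub>0 i) (A (\<phi>\<^sub>1 i)))"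
  have q: "((\<lambda>i. cinner (\<phi>\<^sub>0 i) (A (\<phi>\<^sub>0 i))) has_sum q\<^sub>0) I"
    "((\<lambda>i. cinner (\<phi>\<^sub>1 i) (A (\<phi>\<^sub>1 i))) has_sum q\<^sub>1) I"
    and D: "((\<lambda>i. cinner (\<phi>\<^sub>0 i) (A (\<phi>\<^sub>1 i))) has_sum D) I"
    unfolding q\<^sub>0_def q\<^sub>1_def D_def by (rule summable[OF \<phi>\<^sub>0 \<phi>\<^sub>0] summable[OF \<phi>\<^sub>1 \<phi>\<^sub>1] summable[OF \<phi>\<^sub>0 \<phi>\<^sub>1])+
  have "cinner (\<phi> i) (A (\<phi> i)) = of_real ((cmod \<alpha>\<^sub>0)\<^sup>2) * cinner (\<phi>\<^sub>0 i) (A (\<phi>\<^sub>0 i))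
      + of_real ((cmod \<alpha>\<^sub>1)\<^sup>2) * cinner (\<phi>\<^sub>1 i) (A (\<phi>\<^sub>1 i))
      + (cnj \<alpha>\<^sub>0 * \<alpha>\<^sub>1 * cinner (\<phi>\<^sub>0 i) (A (\<phi>\<^sub>1 i))
        + cnj \<alpha>\<^sub>1 * \<alpha>\<^sub>0 * cnj (cinner (\<phi>\<^sub>0 i) (A (\<phi>\<^sub>1 i))))" for i
  proof -
    have "cnj (cinner (\<phi>\<^sub>0 i) (A (\<phi>\<^sub>1 i))) = cinner (\<phi>\<^sub>1 i) (A (\<phi>\<^sub>0 i))"
      by (metis A_sym cinner_commute)
    then show ?thesis
      unfolding \<phi> complex_norm_square bounded_clinear_add[OF A] bounded_clinear_scaleC[OF A]
      by (simp only: cinner_simps algebra_simps)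
  qed
  moreover have "((\<lambda>i. of_real ((cmod \<alpha>\<^sub>0)\<^sup>2) * cinner (\<phi>\<^sub>0 i) (A (\<phi>\<^sub>0 i))
      + of_real ((cmod \<alpha>\<^sub>1)\<^sup>2) * cinner (\<phi>\<^sub>1 i) (A (\<phi>\<^sub>1 i))
      + (cnj \<alpha>\<^sub>0 * \<alpha>\<^sub>1 * cinner (\<phi>\<^sub>0 i) (A (\<phi>\<^sub>1 i))
        + cnj \<alpha>\<^sub>1 * \<alpha>\<^sub>0 * cnj (cinner (\<phi>\<^sub>0 i) (A (\<phi>\<^sub>1 i)))))
    has_sum (of_real ((cmod \<alpha>\<^sub>0)\<^sup>2) * q\<^sub>0 + of_real ((cmod \<alpha>\<^sub>1)\<^sup>2) * q\<^sub>1
      + (cnj \<alpha>\<^sub>0 * \<alpha>\<^sub>1 * D + cnj \<alpha>\<^sub>1 * \<alpha>\<^sub>0 * cnj D))) I"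
    by (intro has_sum_add has_sum_cmult_right q D) (simp add: D)
  ultimately have "(\<Sum>\<^sub>\<infinity>i\<in>I. cinner (\<phi> i) (A (\<phi> i)))
      - (of_real ((cmod \<alpha>\<^sub>0)\<^sup>2) * q\<^sub>0 + of_real ((cmod \<alpha>\<^sub>1)\<^sup>2) * q\<^sub>1)
    = cnj \<alpha>\<^sub>0 * \<alpha>\<^sub>1 * D + cnj \<alpha>\<^sub>1 * \<alpha>\<^sub>0 * cnj D"
    by (simp add: infsumI)
  moreover have "cmod (cnj \<alpha>\<^sub>0 * \<alpha>\<^sub>1 * D + cnj \<alpha>\<^sub>1 * \<alpha>\<^sub>0 * cnj D) \<le> 2 * cmod \<alpha>\<^sub>0 * cmod \<alpha>\<^sub>1 * cmod D"
    using norm_triangle_ineq[of "cnj \<alpha>\<^sub>0 * \<alpha>\<^sub>1 * D" "cnj \<alpha>\<^sub>1 * \<alpha>\<^sub>0 * cnj D"]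
    by (simp add: norm_mult algebra_simps)
  moreover have "2 * cmod \<alpha>\<^sub>0 * cmod \<alpha>\<^sub>1 * cmod D \<le> 1 * cmod D"
    using sum_squares_bound[of "cmod \<alpha>\<^sub>0" "cmod \<alpha>\<^sub>1"] \<alpha> by (intro mult_right_mono) auto
  ultimately show ?thesis
    by (simp add: q\<^sub>0_def q\<^sub>1_def D_def)
qed

section \<open>From states and unitaries to square-summable families\<close>

lemma cadjoint_compose:
  assumes "bounded_clinear f" "bounded_clinear g"
  shows "cadjoint (\<lambda>x. f (g x)) v = cadjoint g (cadjoint f v)"
  by (rule cinner_extI) (simp add: cinner_cadjoint_left bounded_clinear_compose assms)

lemma unitary_op_norm:
  assumes "unitary_op U"
  shows "norm (U x) = norm x"
proof -
  have U: "bounded_clinear U" and inv: "cadjoint U (U x) = x"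
    using assms by (auto simp: unitary_op_def fun_eq_iff)
  have "inner (U x) (U x) = inner x x"
    by (metis Re_cinner cinner_cadjoint_left[OF U] inv)
  then show ?thesis
    by (simp add: norm_eq_sqrt_inner)
qed

text \<open>The diagonal entry of \<tau> at e is the squared norm of S e, so trace 1 says that S is
  Hilbert-Schmidt of norm 1. The basis is the very one picked by \<open>op_trace\<close>.\<close>

lemma is_state_sqrt:
  fixes \<tau> :: "'a::chilbert_space \<Rightarrow> 'a"
  assumes "is_state \<tau>"
  obtains S where "bounded_clinear S" "\<And>x y. cinner (S x) y = cinner x (S y)" "\<And>x. S (S x) = \<tau> x"
    "((\<lambda>e. (norm (S e))\<^sup>2) has_sum 1) (SOME E. is_onb E)"
proof -
  have \<tau>: "positive_op \<tau>" "op_trace \<tau> = 1"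
    using assms by (auto simp: is_state_def)
  obtain S where S: "bounded_clinear S" "\<And>x y. cinner (S x) y = cinner x (S y)" "\<And>x. S (S x) = \<tau> x"
    using positive_op_sqrt[OF \<tau>(1)] by blast
  have "((\<lambda>e. cinner e (\<tau> e)) has_sum 1) (SOME E. is_onb E)"
    \<comment> \<open>A divergent \<open>infsum\<close> is 0, so trace 1 already forces summability over the basis in \<open>op_trace\<close>.\<close>
    using \<tau>(2) has_sum_infsum infsum_not_exists unfolding op_trace_def by (metis zero_neq_one)
  from has_sum_Re[OF this] have "((\<lambda>e. (norm (S e))\<^sup>2) has_sum 1) (SOME E. is_onb E)"
    by (simp add: S(3)[symmetric] S(2)[symmetric] cinner_self)
  with S show ?thesis
    by (rule that)
qed

lemma selfadjoint_op_cinner: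
  "selfadjoint_op A \<Longrightarrow> cinner (A x) y = cinner x (A y)"
  by (metis selfadjoint_op_def cinner_cadjoint_left)

theorem mainTheorem1:
  fixes tens :: "'k::chilbert_space \<Rightarrow> 'h::chilbert_space \<Rightarrow> 'l::chilbert_space"
    and \<psi>\<^sub>0 \<psi>\<^sub>1 \<psi> :: 'h
    and \<tau> :: "'k \<Rightarrow> 'k"
    and U A B :: "'l \<Rightarrow> 'l"
    and T :: "('h \<Rightarrow> 'h) \<Rightarrow> ('l \<Rightarrow> 'l)"
    and b\<^sub>0 b\<^sub>1 \<sigma>\<^sub>0 \<sigma>\<^sub>1 \<delta> :: real
    and \<alpha>\<^sub>0 \<alpha>\<^sub>1 :: complex
  assumes "is_hilbert_tensor tens"
    and "norm \<psi>\<^sub>0 = 1" and "norm \<psi>\<^sub>1 = 1" and "cinner \<psi>\<^sub>0 \<psi>\<^sub>1 = 0"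
    and "is_state \<tau>"
    and "unitary_op U"
    and "T = (\<lambda>\<rho>. U \<circ> tensor_op tens \<tau> \<rho> \<circ> cadjoint U)"
    and "selfadjoint_op B"
    and "b\<^sub>0 = expected_value (T (rank_one_proj \<psi>\<^sub>0)) B"
    and "b\<^sub>1 = expected_value (T (rank_one_proj \<psi>\<^sub>1)) B"
    and "\<sigma>\<^sub>0 = sqrt (op_variance (T (rank_one_proj \<psi>\<^sub>0)) B)"
    and "\<sigma>\<^sub>1 = sqrt (op_variance (T (rank_one_proj \<psi>\<^sub>1)) B)"
    and "b\<^sub>0 \<noteq> b\<^sub>1"
    and "\<psi> = \<alpha>\<^sub>0 *\<^sub>C \<psi>\<^sub>0 + \<alpha>\<^sub>1 *\<^sub>C \<psi>\<^sub>1"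
    and "(cmod \<alpha>\<^sub>0)\<^sup>2 + (cmod \<alpha>\<^sub>1)\<^sup>2 = 1"
    and "\<delta> \<ge> 0"
    and "selfadjoint_op A"
    and "onorm (commutator A B) \<le> \<delta> * onorm A * onorm B"
  shows "cmod (op_trace (T (rank_one_proj \<psi>) \<circ> A)
      - op_trace (T (\<lambda>x. (cmod \<alpha>\<^sub>0)\<^sup>2 *\<^sub>R rank_one_proj \<psi>\<^sub>0 x
                        + (cmod \<alpha>\<^sub>1)\<^sup>2 *\<^sub>R rank_one_proj \<psi>\<^sub>1 x) \<circ> A))
    \<le> (\<delta> * onorm B + \<sigma>\<^sub>0 + \<sigma>\<^sub>1) / \<bar>b\<^sub>0 - b\<^sub>1\<bar> * onorm A"
proof -
  note tens = assms(1) and T = assms(7)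
  \<comment> \<open>These are the bases inside \<open>op_trace\<close> on the two spaces: the
    normalisation of \<tau> is a sum over \<open>E\<close>, the traces in the claim are sums over
    \<open>F\<close>.\<close>
  define E :: "'k set" where "E = (SOME E. is_onb E)"
  define F :: "'l set" where "F = (SOME F. is_onb F)"
  have onb: "is_onb E" "is_onb F"
    unfolding E_def F_def by (rule someI_ex[OF exists_onb])+
  obtain S where S: "bounded_clinear S" "\<And>x y. cinner (S x) y = cinner x (S y)" "\<And>x. S (S x) = \<tau> x"
    and S_sum: "((\<lambda>e. (norm (S e))\<^sup>2) has_sum 1) E"
    using is_state_sqrt[OF assms(5)] unfolding E_def by blast
  have \<tau>: "bounded_clinear \<tau>" and U: "bounded_clinear U"
    and A: "bounded_clinear A" and B: "bounded_clinear B"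
    using assms by (auto simp: is_state_def positive_op_def unitary_op_def selfadjoint_op_def)
  define \<phi> where "\<phi> \<xi> e = U (tens (S e) \<xi>)" for \<xi> e
  have sum1: "((\<lambda>e. (norm (\<phi> \<xi> e))\<^sup>2) has_sum 1) E" if "norm \<xi> = 1" for \<xi>
    using S_sum that by (simp add: \<phi>_def unitary_op_norm[OF assms(6)] norm_tens[OF tens])
  define q where "q \<xi> C = (\<Sum>\<^sub>\<infinity>e\<in>E. cinner (\<phi> \<xi> e) (C (\<phi> \<xi> e)))" for \<xi> C
  \<comment> \<open>The trace formula with W sending x to \<open>U (tens x \<xi>)\<close>; the
    adjoint of W is that of \<open>U\<close> followed by the contraction against \<xi>.\<close>
  have trace: "((\<lambda>f. cinner f (U (tensor_rank_one tens \<tau> \<xi> (cadjoint U (C f))))) has_sum q \<xi> C) F"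
    if C: "bounded_clinear C" for \<xi> C
  proof -
    note V = bounded_clinear_tens_left[OF tens, of \<xi>]
    show ?thesis
      using trace_conjugated_square[OF S(1,2) bounded_clinear_compose[OF U V] C onb
          has_sum_imp_summable[OF S_sum]]
      by (simp add: cadjoint_compose[OF U V] S(3) tensor_rank_one_def[OF tens] q_def \<phi>_def)
  qed
  have trace_pure: "op_trace (T (rank_one_proj \<xi>) \<circ> C) = q \<xi> C" if "bounded_clinear C" for \<xi> C
    using infsumI[OF trace[OF that]]
    by (simp add: op_trace_def T tensor_op_rank_one[OF tens \<tau>] F_def)
  have trace_mixed: "op_trace (T (\<lambda>x. (cmod \<alpha>\<^sub>0)\<^sup>2 *\<^sub>R rank_one_proj \<psi>\<^sub>0 x
      + (cmod \<alpha>\<^sub>1)\<^sup>2 *\<^sub>R rank_one_proj \<psi>\<^sub>1 x) \<circ> A) = (cmod \<alpha>\<^sub>0)\<^sup>2 * q \<psi>\<^sub>0 A + (cmod \<alpha>\<^sub>1)\<^sup>2 * q \<psi>\<^sub>1 A"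
    using infsumI[OF has_sum_add[OF has_sum_cmult_right[OF trace[OF A, of \<psi>\<^sub>0], of "(cmod \<alpha>\<^sub>0)\<^sup>2"]
        has_sum_cmult_right[OF trace[OF A, of \<psi>\<^sub>1], of "(cmod \<alpha>\<^sub>1)\<^sup>2"]]]
    by (simp add: op_trace_def T tensor_op_mixture[OF tens \<tau>] F_def bounded_clinear_add[OF U]
        bounded_clinear_scaleR[OF U] cinner_add_right cinner_scaleR_right)
  have expectation: "expected_value (T (rank_one_proj \<xi>)) B
      = Re (\<Sum>\<^sub>\<infinity>e\<in>E. cinner (\<phi> \<xi> e) (B (\<phi> \<xi> e)))" for \<xi>
    by (simp add: expected_value_def trace_pure[OF B] q_def)
  have variance: "op_variance (T (rank_one_proj \<xi>)) B
      = (\<Sum>\<^sub>\<infinity>e\<in>E. (norm (B (\<phi> \<xi> e)))\<^sup>2) - (expected_value (T (rank_one_proj \<xi>)) B)\<^sup>2"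
    if \<xi>: "norm \<xi> = 1" for \<xi>
  proof -
    have "bounded_clinear (B \<circ> B)"
      unfolding comp_def by (rule bounded_clinear_compose[OF B B])
    moreover have "(\<lambda>e. (norm (B (\<phi> \<xi> e)))\<^sup>2) summable_on E"
      by (rule square_summable_bounded_linear(1)
          [OF bounded_clinear_imp_bounded_linear[OF B] has_sum_imp_summable[OF sum1[OF \<xi>]]])
    \<comment> \<open>Moving one \<open>B\<close> to the left argument turns each term into a
      squared norm, so the second moment is real and matches the form of the variance used for the
      cross term.\<close>
    then have "q \<xi> (B \<circ> B) = of_real (\<Sum>\<^sub>\<infinity>e\<in>E. (norm (B (\<phi> \<xi> e)))\<^sup>2)"
      by (simp add: q_def selfadjoint_op_cinner[OF assms(8), symmetric] cinner_self
          infsumI[OF has_sum_of_real[OF has_sum_infsum]] del: of_real_power)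
    ultimately show ?thesis
      by (simp add: op_variance_def trace_pure)
  qed
  define D where "D = (\<Sum>\<^sub>\<infinity>e\<in>E. cinner (\<phi> \<psi>\<^sub>0 e) (A (\<phi> \<psi>\<^sub>1 e)))"
  have "\<phi> \<psi> e = \<alpha>\<^sub>0 *\<^sub>C \<phi> \<psi>\<^sub>0 e + \<alpha>\<^sub>1 *\<^sub>C \<phi> \<psi>\<^sub>1 e" for e
    by (simp add: assms(14) \<phi>_def tens_add_right[OF tens] tens_scaleC_right[OF tens]
        bounded_clinear_add[OF U] bounded_clinear_scaleC[OF U])
  from superposition_defect[OF A selfadjoint_op_cinner[OF assms(17)]
      has_sum_imp_summable[OF sum1[OF assms(2)]] has_sum_imp_summable[OF sum1[OF assms(3)]]
      assms(15) this]
  have defect: "cmod (op_trace (T (rank_one_proj \<psi>) \<circ> A)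
      - op_trace (T (\<lambda>x. (cmod \<alpha>\<^sub>0)\<^sup>2 *\<^sub>R rank_one_proj \<psi>\<^sub>0 x
                        + (cmod \<alpha>\<^sub>1)\<^sup>2 *\<^sub>R rank_one_proj \<psi>\<^sub>1 x) \<circ> A)) \<le> cmod D"
    unfolding trace_mixed trace_pure[OF A] q_def D_def .
  have "\<bar>b\<^sub>0 - b\<^sub>1\<bar> * cmod D \<le> onorm (commutator A B) + (\<sigma>\<^sub>0 + \<sigma>\<^sub>1) * onorm A"
    unfolding D_def
    by (rule cross_term_bound[OF A B selfadjoint_op_cinner[OF assms(17)]
          selfadjoint_op_cinner[OF assms(8)] sum1[OF assms(2)] sum1[OF assms(3)]])
      (simp_all add: assms(9-12) expectation variance assms(2,3))
  also have "\<dots> \<le> (\<delta> * onorm B + \<sigma>\<^sub>0 + \<sigma>\<^sub>1) * onorm A"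
    using assms(18) by (simp add: algebra_simps)
  finally have "cmod D \<le> (\<delta> * onorm B + \<sigma>\<^sub>0 + \<sigma>\<^sub>1) / \<bar>b\<^sub>0 - b\<^sub>1\<bar> * onorm A"
    using assms(13) by (simp add: field_simps)
  with defect show ?thesis
    by linarith
qed

end
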